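(* Let $n\ge1$, let $-1/n\leq p<0$, let $\lambda\in(0,1)$ and let $f,g:\mathbb{R}^n\to\mathbb{R}_{\geq0}\cup\{\infty\}$ be non-negative measurable functions such that $(1-\lambda) f\star_p\lambda g$ is measurable. If there exists a hyperplane $H\in\mathcal{L}^n_{n-1}$ such that $$(1-\lambda)S_H(f)\star_p\lambda S_H(g)\quad\text{and}\quad(1-\lambda)S_{H^\perp}\bigl(S_H(f)\bigr)\star_{-\infty}\lambda S_{H^\perp}\bigl(S_H(g)\bigr)$$ are measurable functions and $$\int_H \mathrm{proj}_H(f)(x)\,\mathrm{d} x=\int_H \mathrm{proj}_H(g)(x)\,\mathrm{d} x,$$ then $$\int_{\mathbb{R}^n}(1-\lambda) f\star_p\lambda g\,\mathrm{d} x\;\geq\;(1-\lambda)\int_{\mathbb{R}^n}f\,\mathrm{d} x +\lambda\int_{\mathbb{R}^n}g\,\mathrm{d} x.$$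
   Context: Measurable means Lebesgue measurable; $\mathrm{vol}_k$ is $k$-dimensional Lebesgue measure; integrals of non-negative functions take values in $[0,\infty]$. $\mathcal{L}^n_{n-1}$ is the set of $(n-1)$-dimensional linear subspaces of $\mathbb{R}^n$; $A|H$ is the orthogonal projection of $A$ onto $H$. For $-\infty\le p<0$, $\lambda\in(0,1)$ and $a,b\in[0,\infty]$: $M_p(a,b,\lambda)=0$ if $a=0$ or $b=0$; otherwise $M_p(a,b,\lambda)=((1-\lambda)a^p+\lambda b^p)^{1/p}$ for $p>-\infty$ (with $\infty^p=0$, $0^{1/p}=\infty$) and $M_{-\infty}(a,b,\lambda)=\min\{a,b\}$. For $f,g:\mathbb{R}^n\to\mathbb{R}_{\ge0}\cup\{\infty\}$, $$\bigl((1-\lambda)f\star_p\lambda g\bigr)(x)=\sup_{(1-\lambda)x_1+\lambda x_2=x}M_p(f(x_1),g(x_2),\lambda).$$ Projection: for $H$ with unit normal $\nu$, $\mathrm{proj}_H(f)(h)=\sup_{\alpha\in\mathbb{R}} f(h+\alpha\nu)\in[0,\infty]$, $h\in H$. Steiner symmetral of a set: for a nonempty measurable $A\subset\mathbb{R}^n$, $$S_H(A)=\{h+l:\ h\in A|H,\ l\in H^\perp,\ |l|\le \tfrac12\mathrm{vol}_1(A\cap(h+H^\perp))\},$$ and $S_H(\emptyset)=\emptyset$ (for the null set of $h$ where the section is not measurable, $\mathrm{vol}_1$ is read as outer measure). Steiner symmetral of a function: for measurable $f:\mathbb{R}^n\to\mathbb{R}_{\ge0}\cup\{\infty\}$ write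 $f=e^{-u}$ with $u=-\log f$ ($\log 0=-\infty$, $\log\infty=\infty$), let $\mathrm{epi}_s(u)=\{(x,t)\in\mathbb{R}^n\times\mathbb{R}: t>u(x)\}$, $\widetilde H=H\times\mathbb{R}$ (a hyperplane of $\mathbb{R}^{n+1}$), and $u_H(x)=\inf\{r\in\mathbb{R}:(x,r)\in S_{\widetilde H}(\mathrm{epi}_s(u))\}$ ($\inf\emptyset=\infty$). Then $S_H(f)=e^{-u_H}:\mathbb{R}^n\to\mathbb{R}_{\ge0}\cup\{\infty\}$. Schwarz-type symmetrization: for measurable $f:\mathbb{R}^n\to\mathbb{R}_{\ge0}\cup\{\infty\}$, $S_{H^\perp}(f)(h+\alpha\nu)=d_\alpha\,\chi_{B_{n-1}}(h)$ for $h\in H$, $\alpha\in\mathbb{R}$, where $\nu$ is a unit normal of $H$, $d_\alpha=\int_{\alpha\nu+H}f|_{(\alpha\nu+H)}\,\mathrm{d}x$ ($(n-1)$-dimensional Lebesgue integral; upper integral for the null set of $\alpha$ where the restriction is not measurable), $\chi$ denotes a characteristic function, $B_{n-1}\subset H$ is the Euclidean ball centred at the origin with $\mathrm{vol}_{n-1}(B_{n-1})=1$, and $\infty\cdot0=0$. *)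

theory Defs
  imports "HOL-Analysis.Analysis"
begin

section \<open>Means and sup-convolution\<close>

text \<open>Powers of elements of \<open>[0,\<infinity>]\<close>, meant for negative exponents only:
  \<open>0\<close> and \<open>\<infinity>\<close> are exchanged.\<close>

definition neg_pow :: "ennreal \<Rightarrow> real \<Rightarrow> ennreal" where
  "neg_pow a p = (if a = 0 then \<infinity> else if a = \<infinity> then 0 else ennreal (enn2real a powr p))"

text \<open>The argument \<open>p\<close> is meant to range over \<open>-\<infinity> \<le> p < 0\<close>.\<close>

definition p_mean :: "ereal \<Rightarrow> ennreal \<Rightarrow> ennreal \<Rightarrow> real \<Rightarrow> ennreal" where
  "p_mean p a b lam =
     (if a = 0 \<or> b = 0 then 0
      else if p = -\<infinity> then min a b
      else neg_pow (ennreal (1 - lam) * neg_pow a (real_of_ereal p)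
                    + ennreal lam * neg_pow b (real_of_ereal p))
                   (1 / real_of_ereal p))"

definition sup_conv ::
    "ereal \<Rightarrow> real \<Rightarrow> ('a::real_vector \<Rightarrow> ennreal) \<Rightarrow> ('a \<Rightarrow> ennreal) \<Rightarrow> 'a \<Rightarrow> ennreal" where
  "sup_conv p lam f g x =
     Sup {p_mean p (f x1) (g x2) lam | x1 x2. (1 - lam) *\<^sub>R x1 + lam *\<^sub>R x2 = x}"


section \<open>Hyperplanes and Lebesgue measure on linear subspaces\<close>

definition linear_hyperplanes :: "'a::euclidean_space set set" where
  "linear_hyperplanes = {H. subspace H \<and> dim H = DIM('a) - 1}"

text \<open>Unique up to sign; none of the notions below depends on the sign.\<close>

definition unit_normal :: "'a::euclidean_space set \<Rightarrow> 'a" where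
  "unit_normal H = (SOME v. norm v = 1 \<and> v \<in> orthogonal_comp H)"

definition orthonormal_basis :: "'a::euclidean_space set \<Rightarrow> 'a set" where
  "orthonormal_basis V =
     (SOME B. B \<subseteq> V \<and> pairwise orthogonal B \<and> (\<forall>b\<in>B. norm b = 1) \<and> independent B \<and> span B = V)"

text \<open>Lebesgue measure of dimension \<open>dim V\<close> on a linear subspace \<open>V\<close>: the image of the product
  measure under orthonormal coordinates (compare the definition of \<^const>\<open>lborel\<close>), completed.
  It does not depend on the orthonormal basis. For \<open>V = {0}\<close> it is the unit mass at \<open>0\<close>.\<close>

definition lebesgue_sub :: "'a::euclidean_space set \<Rightarrow> 'a measure" where
  "lebesgue_sub V =
     completion (distr (\<Pi>\<^sub>M b\<in>orthonormal_basis V. (lborel :: real measure)) (restrict_space borel V)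
       (\<lambda>c. \<Sum>b\<in>orthonormal_basis V. c b *\<^sub>R b))"

definition orth_proj :: "'a::euclidean_space set \<Rightarrow> 'a set \<Rightarrow> 'a set" where
  "orth_proj A H = {h \<in> H. \<exists>a\<in>A. a - h \<in> orthogonal_comp H}"

definition proj_fun :: "'a::euclidean_space set \<Rightarrow> ('a \<Rightarrow> ennreal) \<Rightarrow> 'a \<Rightarrow> ennreal" where
  "proj_fun H f h = (SUP \<alpha>. f (h + \<alpha> *\<^sub>R unit_normal H))"


section \<open>Steiner symmetrization\<close>

text \<open>The \<open>vol\<^sub>1\<close> of the section of \<open>A\<close> by \<open>h + H\<^sup>\<bottom>\<close>, after translating that line by \<open>- h\<close> to \<open>H\<^sup>\<bottom>\<close>;
  the outer measure is the measure whenever the section is measurable.\<close>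

definition section_length :: "'a::euclidean_space set \<Rightarrow> 'a set \<Rightarrow> 'a \<Rightarrow> ennreal" where
  "section_length H A h =
     outer_measure_of (lebesgue_sub (orthogonal_comp H)) {l \<in> orthogonal_comp H. h + l \<in> A}"

definition steiner_set :: "'a::euclidean_space set \<Rightarrow> 'a set \<Rightarrow> 'a set" where
  "steiner_set H A =
     {h + l | h l. h \<in> orth_proj A H \<and> l \<in> orthogonal_comp H
        \<and> ennreal (norm l) \<le> section_length H A h / 2}"

text \<open>\<open>-log : [0,\<infinity>] \<rightarrow> [-\<infinity>,\<infinity>]\<close> and its inverse \<open>u \<mapsto> e\<^sup>-\<^sup>u\<close>.\<close>

definition neg_log :: "ennreal \<Rightarrow> ereal" where
  "neg_log a = (if a = 0 then \<infinity> else if a = \<infinity> then -\<infinity> else ereal (- ln (enn2real a)))"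

definition exp_neg :: "ereal \<Rightarrow> ennreal" where
  "exp_neg u = (if u = \<infinity> then 0 else if u = -\<infinity> then \<infinity> else ennreal (exp (- real_of_ereal u)))"

definition strict_epigraph :: "('a \<Rightarrow> ereal) \<Rightarrow> ('a \<times> real) set" where
  "strict_epigraph u = {(x, t). u x < ereal t}"

definition steiner_fun :: "'a::euclidean_space set \<Rightarrow> ('a \<Rightarrow> ennreal) \<Rightarrow> 'a \<Rightarrow> ennreal" where
  "steiner_fun H f x =
     exp_neg (Inf {ereal r | r.
       (x, r) \<in> steiner_set (H \<times> UNIV) (strict_epigraph (\<lambda>y. neg_log (f y)))})"


section \<open>Schwarz-type symmetrization\<close>

definition upper_nn_integral :: "'a measure \<Rightarrow> ('a \<Rightarrow> ennreal) \<Rightarrow> ennreal" where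
  "upper_nn_integral M f =
     (INF g \<in> {g \<in> borel_measurable M. \<forall>x\<in>space M. f x \<le> g x}. \<integral>\<^sup>+x. g x \<partial>M)"

text \<open>The ball is \<open>{0}\<close> for every radius if \<open>H = {0}\<close>.\<close>

definition unit_volume_ball :: "'a::euclidean_space set \<Rightarrow> 'a set" where
  "unit_volume_ball H =
     H \<inter> cball 0 (SOME r. 0 < r \<and> emeasure (lebesgue_sub H) (H \<inter> cball 0 r) = 1)"

text \<open>Here \<open>x = h + \<alpha>\<nu>\<close> with \<open>\<alpha> = x \<bullet> \<nu>\<close> and \<open>h \<in> H\<close>. The integral over \<open>\<alpha>\<nu> + H\<close> is translated to
  \<open>H\<close>; the upper integral is the integral whenever the restriction of \<open>f\<close> is measurable.\<close>

definition schwarz_fun :: "'a::euclidean_space set \<Rightarrow> ('a \<Rightarrow> ennreal) \<Rightarrow> 'a \<Rightarrow> ennreal" where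
  "schwarz_fun H f x =
     (let \<nu> = unit_normal H; \<alpha> = x \<bullet> \<nu>; h = x - \<alpha> *\<^sub>R \<nu>
      in upper_nn_integral (lebesgue_sub H) (\<lambda>y. f (\<alpha> *\<^sub>R \<nu> + y)) * indicator (unit_volume_ball H) h)"

end

theory Submission
  imports Defs
begin

text \<open>Write \<open>\<real>\<^sup>n = H \<times> \<real>\<nu>\<close> and replace each fibre \<open>f(x, _)\<close>, \<open>x \<in> H\<close>, by its decreasing rearrangement
  \<open>f*(x, a)\<close> in \<open>a > 0\<close>. One-dimensional Brunn--Minkowski on the level sets of the fibres shows that
  the rearrangement of \<open>(1-\<lambda>)f \<star>\<^sub>p \<lambda>g\<close> at \<open>((1-\<lambda>)x + \<lambda>y, (1-\<lambda>)a + \<lambda>b)\<close> dominates the \<open>p\<close>-mean of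
  \<open>f*(x, a)\<close> and \<open>g*(y, b)\<close>. Since \<open>p \<ge> -1/n\<close>, the Borell--Brascamp--Lieb inequality on the
  \<open>(n-1)\<close>-dimensional \<open>H\<close> gives \<open>D\<^sub>h((1-\<lambda>)a + \<lambda>b) \<ge> min (D\<^sub>f(a)) (D\<^sub>g(b))\<close> for \<open>D\<^sub>u(a) = \<integral>\<^sub>H u*(x, a) dx\<close>.
  Assigning to \<open>D\<^sub>f\<close> and \<open>D\<^sub>g\<close> at \<open>a = 0\<close> the integrals of the projections, which are their suprema,
  makes these suprema equal, and then level sets of functions of one variable yield the linear
  inequality.\<close>

section \<open>Level sets and Brunn--Minkowski on the line\<close>

text \<open>Applied to all n coordinates at once, Borell--Brascamp--Lieb yields only a mean with
  exponent \<open>p / (1 + n * p)\<close>, far below the linear one. The linear mean comes from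
  treating one direction differently: rearranging along \<nu> costs no exponent, and the remaining
  variable a is integrated last, when equal suprema allow level sets to be compared directly. Each
  coordinate of H replaces p by \<open>p / (p + 1)\<close>, that is, lowers -1/p by one. After n - 1
  coordinates -1/p is still at least 1, so the exponent is finite and negative and its mean
  dominates the minimum. The obstacle is null sets. The functions are only Lebesgue measurable, the
  sup-convolution is defined pointwise, and a change on a null set can change a projection. Hence
  Borel minorants carry the integrals of f and g, the original f and g carry the projections and the
  pointwise inequality, and a Borel majorant replaces the sup-convolution. Projections may fail to
  be measurable, but \<open>nn_integral\<close> is a supremum over simple minorants, and these
  suffice.\<close>

lemma nn_integral_ennreal_levels:
  "(\<integral>\<^sup>+t. indicator {t. 0 < t \<and> ennreal t < a} t \<partial>lborel) = a"
proof (cases a)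
  case (real r)
  then have "{t. 0 < t \<and> ennreal t < a} = {0<..<r}"
    by (auto simp: ennreal_less_iff)
  then show ?thesis using real by simp
next
  case top
  have "\<infinity> = (SUP n. emeasure lborel {0<..<real n})"
    by (simp add: ennreal_SUP_of_nat_eq_top flip: ennreal_of_nat_eq_real_of_nat)
  also have "\<dots> \<le> emeasure lborel {0::real<..}"
    by (intro SUP_least emeasure_mono) auto
  finally have "emeasure lborel {0::real<..} = \<infinity>"
    by (simp add: top_unique)
  moreover have "{t. 0 < t \<and> ennreal t < a} = {0<..}"
    using top by auto
  ultimately show ?thesis using top by simp
qed

text \<open>Each value \<open>f x\<close> is the length of the interval of positive levels below it;
  the formula is the exchange of the integrations over x and over levels.\<close>

lemma nn_integral_layer_cake:
  assumes "sigma_finite_measure M" and [measurable]: "f \<in> borel_measurable M"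
  shows "(\<integral>\<^sup>+x. f x \<partial>M) =
    (\<integral>\<^sup>+t. indicator {0<..} t * emeasure M {x \<in> space M. ennreal t < f x} \<partial>lborel)"
proof -
  interpret sigma_finite_measure M by fact
  interpret pair_sigma_finite M "lborel :: real measure" ..
  have "(\<integral>\<^sup>+x. f x \<partial>M) = (\<integral>\<^sup>+x. (\<integral>\<^sup>+t. indicator {t. 0 < t \<and> ennreal t < f x} t \<partial>lborel) \<partial>M)"
    by (simp add: nn_integral_ennreal_levels)
  also have "\<dots> = (\<integral>\<^sup>+t. (\<integral>\<^sup>+x. indicator {t. 0 < t \<and> ennreal t < f x} t \<partial>M) \<partial>lborel)"
    by (rule Fubini'[symmetric]) measurable
  also have "\<dots> = (\<integral>\<^sup>+t. indicator {0<..} t * emeasure M {x \<in> space M. ennreal t < f x} \<partial>lborel)"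
  proof (rule nn_integral_cong)
    fix t :: real
    have "(\<integral>\<^sup>+x. indicator {t. 0 < t \<and> ennreal t < f x} t \<partial>M) =
      (\<integral>\<^sup>+x. indicator {0<..} t * indicator {x \<in> space M. ennreal t < f x} x \<partial>M)"
      by (intro nn_integral_cong) (auto simp: indicator_def)
    then show "(\<integral>\<^sup>+x. indicator {t. 0 < t \<and> ennreal t < f x} t \<partial>M) =
        indicator {0<..} t * emeasure M {x \<in> space M. ennreal t < f x}"
      by (simp add: nn_integral_cmult)
  qed
  finally show ?thesis .
qed

section \<open>Brunn--Minkowski for sets of reals\<close>

text \<open>Up to the single point \<open>Sup A\<close>, which is null, A is an increasing union of
  pieces below points of A. This replaces compactness: A may be unbounded or miss its
  supremum.\<close>

lemma emeasure_cofinal_atMost: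
  fixes A :: "real set"
  assumes [measurable]: "A \<in> sets borel" and ne: "A \<noteq> {}"
    and le: "\<And>a. a \<in> A \<Longrightarrow> emeasure lborel (A \<inter> {..a}) \<le> c"
  shows "emeasure lborel A \<le> c"
proof -
  have *: "emeasure lborel (A \<inter> {..q}) \<le> c" if "\<exists>a\<in>A. q \<le> a" for q
  proof -
    from that obtain a where "a \<in> A" "q \<le> a" by blast
    then have "emeasure lborel (A \<inter> {..q}) \<le> emeasure lborel (A \<inter> {..a})"
      by (intro emeasure_mono) auto
    also have "\<dots> \<le> c" using le \<open>a \<in> A\<close> by blast
    finally show ?thesis .
  qed
  have seq: "emeasure lborel (\<Union>n. A \<inter> {..q n}) \<le> c"
    if "incseq q" "\<And>n. \<exists>a\<in>A. q n \<le> a" for q :: "nat \<Rightarrow> real"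
  proof -
    have "emeasure lborel (\<Union>n. A \<inter> {..q n}) = (SUP n. emeasure lborel (A \<inter> {..q n}))"
      using that(1) by (intro SUP_emeasure_incseq[symmetric]) (auto simp: incseq_def intro: order_trans)
    also have "\<dots> \<le> c" using that(2) by (intro SUP_least *)
    finally show ?thesis .
  qed
  show ?thesis
  proof (cases "bdd_above A")
    case False
    then have "\<exists>a\<in>A. real n \<le> a" for n
      unfolding bdd_above_def by (meson le_cases)
    then have "emeasure lborel (\<Union>n. A \<inter> {..real n}) \<le> c"
      by (intro seq) (auto simp: incseq_def)
    moreover have "(\<Union>n. A \<inter> {..real n}) = A" by (auto intro: real_arch_simple)
    ultimately show ?thesis by simp
  next
    case True
    define s where "s = Sup A"
    define q where "q n = s - 1 / real (Suc n)" for n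
    have "\<exists>a\<in>A. q n \<le> a" for n
      using less_cSup_iff[OF ne True, of "q n"] by (auto simp: q_def s_def intro: less_imp_le)
    moreover have "incseq q"
      by (auto simp: incseq_def q_def intro!: divide_left_mono)
    ultimately have c: "emeasure lborel (\<Union>n. A \<inter> {..q n}) \<le> c"
      by (rule seq[rotated])
    have "A \<subseteq> insert s (\<Union>n. A \<inter> {..q n})"
    proof
      fix x assume "x \<in> A"
      then have "x \<le> s" using True by (auto simp: s_def intro: cSup_upper)
      show "x \<in> insert s (\<Union>n. A \<inter> {..q n})"
      proof (cases "x = s")
        case False
        then obtain n where "1 / real (Suc n) < s - x"
          using \<open>x \<le> s\<close> reals_Archimedean[of "s - x"] by (auto simp: inverse_eq_divide)
        then show ?thesis using \<open>x \<in> A\<close> by (auto simp: q_def intro!: exI[of _ n])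
      qed simp
    qed
    then have "emeasure lborel A \<le> emeasure lborel ({s} \<union> (\<Union>n. A \<inter> {..q n}))"
      by (intro emeasure_mono) auto
    also have "\<dots> \<le> emeasure lborel {s} + emeasure lborel (\<Union>n. A \<inter> {..q n})"
      by (intro emeasure_subadditive) auto
    finally show ?thesis using c by simp
  qed
qed

lemma emeasure_lborel_uminus:
  fixes A :: "real set"
  assumes [measurable]: "A \<in> sets borel"
  shows "emeasure lborel {x. - x \<in> A} = emeasure lborel A"
proof -
  have "emeasure lborel A = emeasure (distr lborel borel uminus) A"
    by (simp add: lborel_distr_uminus)
  then show ?thesis by (simp add: emeasure_distr vimage_def)
qed

lemma emeasure_lborel_translate:
  fixes A :: "real set"
  assumes [measurable]: "A \<in> sets borel"
  shows "emeasure lborel {x. x - c \<in> A} = emeasure lborel A"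
proof -
  have "emeasure lborel A = emeasure (distr lborel borel ((+) (-c))) A"
    by (simp add: lborel_distr_plus)
  then show ?thesis by (simp add: emeasure_distr vimage_def)
qed

lemma ennreal_add_le_of_le_minus:
  fixes a b c :: ennreal
  assumes "b \<le> c - a" "a \<le> c" "a \<noteq> \<infinity>"
  shows "a + b \<le> c"
proof -
  have "b + a \<le> (c - a) + a" using assms(1) by (rule add_right_mono)
  also have "\<dots> = c" using assms(2) by (rule diff_add_cancel_ennreal)
  finally show ?thesis by (simp add: add.commute)
qed

lemma ennreal_le_minus_of_add_le:
  fixes a b c :: ennreal
  assumes "b + a \<le> c" "a \<noteq> \<infinity>"
  shows "b \<le> c - a"
  using ennreal_minus_mono[OF assms(1) order_refl[of a]] assms(2) by simp

text \<open>Near the top of \<open>A\<close> and the bottom of \<open>B\<close>, the translates \<open>A + b\<close> and \<open>a + B\<close> overlap in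
  at most one point.\<close>

lemma brunn_minkowski_real:
  fixes A B C :: "real set"
  assumes [measurable]: "A \<in> sets borel" "B \<in> sets borel" "C \<in> sets borel"
    and "A \<noteq> {}" "B \<noteq> {}" and sub: "\<And>a b. a \<in> A \<Longrightarrow> b \<in> B \<Longrightarrow> a + b \<in> C"
  shows "emeasure lborel A + emeasure lborel B \<le> emeasure lborel C"
proof -
  have 1: "emeasure lborel (A \<inter> {..a}) + emeasure lborel (B \<inter> {b..}) \<le> emeasure lborel C"
    if "a \<in> A" "b \<in> B" for a b
  proof -
    \<comment> \<open>Dropping the endpoint b costs a null set and makes the two translates below
      disjoint: one lies in \<open>{..a + b}\<close>, the other in
      \<open>{a + b<..}\<close>.\<close>
    have eq: "emeasure lborel (B \<inter> {b..}) = emeasure lborel (B \<inter> {b<..})"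
    proof -
      have "emeasure lborel (B \<inter> {b..}) \<le> emeasure lborel ({b} \<union> (B \<inter> {b<..}))"
        by (intro emeasure_mono) auto
      also have "\<dots> \<le> emeasure lborel {b} + emeasure lborel (B \<inter> {b<..})"
        by (intro emeasure_subadditive) auto
      finally have "emeasure lborel (B \<inter> {b..}) \<le> emeasure lborel (B \<inter> {b<..})" by simp
      moreover have "emeasure lborel (B \<inter> {b<..}) \<le> emeasure lborel (B \<inter> {b..})"
        by (intro emeasure_mono) auto
      ultimately show ?thesis by (rule antisym)
    qed
    have "emeasure lborel (A \<inter> {..a}) + emeasure lborel (B \<inter> {b<..}) =
      emeasure lborel {x. x - b \<in> A \<inter> {..a}} + emeasure lborel {x. x - a \<in> B \<inter> {b<..}}"
      by (intro arg_cong2[where f = "(+)"] emeasure_lborel_translate[symmetric]) auto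
    also have "\<dots> = emeasure lborel ({x. x - b \<in> A \<inter> {..a}} \<union> {x. x - a \<in> B \<inter> {b<..}})"
      by (intro plus_emeasure) auto
    also have "\<dots> \<le> emeasure lborel C"
    proof (intro emeasure_mono subsetI)
      fix x assume "x \<in> {x. x - b \<in> A \<inter> {..a}} \<union> {x. x - a \<in> B \<inter> {b<..}}"
      then consider "x - b \<in> A" | "x - a \<in> B" by blast
      then show "x \<in> C"
      proof cases
        case 1 with sub[OF this \<open>b \<in> B\<close>] show ?thesis by simp
      next
        case 2 with sub[OF \<open>a \<in> A\<close> this] show ?thesis by simp
      qed
    qed simp
    finally show ?thesis using eq by simp
  qed
  \<comment> \<open>Now a climbs to the top of A with b fixed. Infinite measures are split off
    because the argument subtracts; there a single pair of points already makes C infinite.\<close>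
  have 2: "emeasure lborel (B \<inter> {b..}) + emeasure lborel A \<le> emeasure lborel C" if "b \<in> B" for b
  proof (cases "emeasure lborel (B \<inter> {b..}) = \<infinity>")
    case True
    obtain a where "a \<in> A" using \<open>A \<noteq> {}\<close> by blast
    from 1[OF this that] True show ?thesis by (simp add: top_unique)
  next
    case False
    let ?m = "emeasure lborel (B \<inter> {b..})"
    obtain a where a: "a \<in> A" using \<open>A \<noteq> {}\<close> by blast
    have "?m \<le> emeasure lborel (A \<inter> {..a}) + ?m" by simp
    also note 1[OF a that]
    finally have m: "?m \<le> emeasure lborel C" .
    have "emeasure lborel A \<le> emeasure lborel C - ?m"
    proof (rule emeasure_cofinal_atMost)
      fix a assume "a \<in> A"
      from 1[OF this that] False
      show "emeasure lborel (A \<inter> {..a}) \<le> emeasure lborel C - ?m"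
        by (rule ennreal_le_minus_of_add_le)
    qed (use \<open>A \<noteq> {}\<close> in auto)
    from this m False show ?thesis by (rule ennreal_add_le_of_le_minus)
  qed
  show ?thesis
  proof (cases "emeasure lborel A = \<infinity>")
    case True
    obtain b where "b \<in> B" using \<open>B \<noteq> {}\<close> by blast
    from 2[OF this] True show ?thesis by (simp add: top_unique)
  next
    case False
    obtain b where b: "b \<in> B" using \<open>B \<noteq> {}\<close> by blast
    have "emeasure lborel A \<le> emeasure lborel (B \<inter> {b..}) + emeasure lborel A" by simp
    also note 2[OF b]
    finally have AC: "emeasure lborel A \<le> emeasure lborel C" .
    \<comment> \<open>Reflection turns the bottom of B into a top, so the same exhaustion lets b
      descend.\<close>
    have "emeasure lborel {x. - x \<in> B} \<le> emeasure lborel C - emeasure lborel A"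
    proof (rule emeasure_cofinal_atMost)
      show "{x. - x \<in> B} \<noteq> {}" using b by (auto intro: exI[of _ "- b"])
      fix a assume "a \<in> {x. - x \<in> B}"
      then have a: "- a \<in> B" by simp
      have "emeasure lborel ({x. - x \<in> B} \<inter> {..a}) = emeasure lborel {x. - x \<in> B \<inter> {-a..}}"
        by (rule arg_cong[where f = "emeasure lborel"]) auto
      moreover have "emeasure lborel {x. - x \<in> B \<inter> {-a..}} = emeasure lborel (B \<inter> {-a..})"
        by (rule emeasure_lborel_uminus) simp
      ultimately have "emeasure lborel ({x. - x \<in> B} \<inter> {..a}) = emeasure lborel (B \<inter> {-a..})"
        by (rule trans)
      with 2[OF a] have "emeasure lborel ({x. - x \<in> B} \<inter> {..a}) + emeasure lborel A \<le> emeasure lborel C"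
        by (simp only:)
      then show "emeasure lborel ({x. - x \<in> B} \<inter> {..a}) \<le> emeasure lborel C - emeasure lborel A"
        using False by (rule ennreal_le_minus_of_add_le)
    qed simp
    then have "emeasure lborel B \<le> emeasure lborel C - emeasure lborel A"
      by (simp only: emeasure_lborel_uminus[OF assms(2)])
    from this AC False show ?thesis by (rule ennreal_add_le_of_le_minus)
  qed
qed

lemma emeasure_lborel_scale:
  fixes A :: "real set"
  assumes [measurable]: "A \<in> sets borel" and "0 < c"
  shows "emeasure lborel {x. x / c \<in> A} = ennreal c * emeasure lborel A"
proof -
  have "(\<integral>\<^sup>+x. indicator {x. x / c \<in> A} x \<partial>lborel) =
    ennreal \<bar>c\<bar> * (\<integral>\<^sup>+x. indicator {x. x / c \<in> A} (0 + c * x) \<partial>lborel)"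
    using \<open>0 < c\<close> by (intro nn_integral_real_affine) auto
  moreover have "indicator {x. x / c \<in> A} (0 + c * x) = (indicator A x :: ennreal)" for x
    using \<open>0 < c\<close> by (simp add: indicator_def)
  ultimately show ?thesis using \<open>0 < c\<close> by simp
qed

lemma brunn_minkowski_real_convex:
  fixes A B C :: "real set"
  assumes [measurable]: "A \<in> sets borel" "B \<in> sets borel" "C \<in> sets borel"
    and "A \<noteq> {}" "B \<noteq> {}" and l: "0 < l" "l < 1"
    and sub: "\<And>a b. a \<in> A \<Longrightarrow> b \<in> B \<Longrightarrow> (1 - l) * a + l * b \<in> C"
  shows "ennreal (1 - l) * emeasure lborel A + ennreal l * emeasure lborel B \<le> emeasure lborel C"
proof -
  have "emeasure lborel {x. x / (1 - l) \<in> A} + emeasure lborel {x. x / l \<in> B} \<le> emeasure lborel C"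
  proof (rule brunn_minkowski_real)
    obtain a b where "a \<in> A" "b \<in> B" using \<open>A \<noteq> {}\<close> \<open>B \<noteq> {}\<close> by blast
    then have "a * (1 - l) \<in> {x. x / (1 - l) \<in> A}" "b * l \<in> {x. x / l \<in> B}" using l by auto
    then show "{x. x / (1 - l) \<in> A} \<noteq> {}" "{x. x / l \<in> B} \<noteq> {}" by blast+
    fix a b assume "a \<in> {x. x / (1 - l) \<in> A}" "b \<in> {x. x / l \<in> B}"
    then show "a + b \<in> C" using sub[of "a / (1 - l)" "b / l"] l by simp
  qed auto
  then show ?thesis using l by (simp add: emeasure_lborel_scale)
qed

text \<open>The level sets of F and G at height t add up inside that of X by Brunn--Minkowski, which
  requires both to be nonempty. Equal suprema guarantee that at every height they are both nonempty
  or both empty; integrating over t gives the claim.\<close>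

lemma one_dim_min_inequality:
  fixes F G X :: "real \<Rightarrow> ennreal"
  assumes [measurable]: "F \<in> borel_measurable borel" "G \<in> borel_measurable borel"
      "X \<in> borel_measurable borel"
    and l: "0 < l" "l < 1" and sup: "(SUP x. F x) = (SUP x. G x)"
    and min: "\<And>x y. min (F x) (G y) \<le> X ((1 - l) * x + l * y)"
  shows "ennreal (1 - l) * (\<integral>\<^sup>+x. F x \<partial>lborel) + ennreal l * (\<integral>\<^sup>+x. G x \<partial>lborel)
    \<le> (\<integral>\<^sup>+x. X x \<partial>lborel)"
proof -
  define m where "m f t = indicator {0::real<..} t * emeasure lborel {x::real. ennreal t < f x}" for f t
  have [measurable]: "m f \<in> borel_measurable borel" if [measurable]: "f \<in> borel_measurable borel" for f
    unfolding m_def by measurable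
  have eq: "(\<integral>\<^sup>+x. f x \<partial>lborel) = (\<integral>\<^sup>+t. m f t \<partial>lborel)" if "f \<in> borel_measurable borel" for f
    using nn_integral_layer_cake[OF lborel.sigma_finite_measure_axioms, of f] that by (simp add: m_def)
  have "ennreal (1 - l) * m F t + ennreal l * m G t \<le> m X t" for t
  proof (cases "ennreal t < (SUP x. F x)")
    case False
    then have "{x. ennreal t < F x} = {}" "{x. ennreal t < G x} = {}"
      using False[unfolded sup] by (simp_all add: less_SUP_iff)
    then show ?thesis by (simp add: m_def)
  next
    case True
    then have "\<exists>x. ennreal t < F x" "\<exists>x. ennreal t < G x"
      using True[unfolded sup] by (simp_all add: less_SUP_iff)
    then have ne: "{x. ennreal t < F x} \<noteq> {}" "{x. ennreal t < G x} \<noteq> {}"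
      by blast+
    have "ennreal (1 - l) * emeasure lborel {x. ennreal t < F x}
        + ennreal l * emeasure lborel {x. ennreal t < G x} \<le> emeasure lborel {x. ennreal t < X x}"
    proof (rule brunn_minkowski_real_convex[OF _ _ _ ne l])
      fix a b assume "a \<in> {x. ennreal t < F x}" "b \<in> {x. ennreal t < G x}"
      then have "ennreal t < min (F a) (G b)" by simp
      also note min
      finally show "(1 - l) * a + l * b \<in> {x. ennreal t < X x}" by simp
    qed measurable
    then show ?thesis by (auto simp: m_def indicator_def)
  qed
  then have "(\<integral>\<^sup>+t. ennreal (1 - l) * m F t + ennreal l * m G t \<partial>lborel) \<le> (\<integral>\<^sup>+t. m X t \<partial>lborel)"
    by (intro nn_integral_mono)
  then show ?thesis by (simp add: eq[OF assms(1)] eq[OF assms(2)] eq[OF assms(3)] nn_integral_add nn_integral_cmult)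
qed

section \<open>Means with negative exponent\<close>

lemma neg_pow_antimono:
  assumes "p < 0" "a \<le> b"
  shows "neg_pow b p \<le> neg_pow a p"
proof (cases "a = 0 \<or> b = \<infinity>")
  case False
  then have "a \<noteq> \<infinity>" "b \<noteq> 0" using assms(2) by (auto simp: top_unique)
  with False obtain x y where "a = ennreal x" "b = ennreal y" "0 < x" "0 < y"
    by (metis ennreal_cases ennreal_eq_0_iff infinity_ennreal_def not_le)
  with assms show ?thesis
    by (auto simp: neg_pow_def intro!: ennreal_leI powr_mono2')
qed (auto simp: neg_pow_def)

lemma neg_pow_neg_pow:
  assumes "p < 0"
  shows "neg_pow (neg_pow a p) (1 / p) = a"
  using assms by (cases a) (auto simp: neg_pow_def powr_powr powr_one)

lemma neg_pow_cmult:
  assumes "0 < c"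
  shows "neg_pow (ennreal c * a) p = ennreal (c powr p) * neg_pow a p"
  using assms by (cases a) (auto simp: neg_pow_def ennreal_mult_top powr_mult simp flip: ennreal_mult'')

lemma ennreal_inverse_antimono:
  fixes a b :: ennreal
  assumes "a \<le> b"
  shows "inverse b \<le> inverse a"
proof (cases "a = 0 \<or> b = top")
  case False
  then have "a \<noteq> top" "b \<noteq> 0" using assms by (auto simp: top_unique)
  with False obtain x y where "a = ennreal x" "b = ennreal y" "0 < x" "0 < y"
    by (metis ennreal_cases ennreal_eq_0_iff not_le)
  with assms show ?thesis by (auto simp: inverse_ennreal intro!: ennreal_leI)
qed auto

lemma ennreal_inverse_inverse: "inverse (inverse a) = (a :: ennreal)"
proof (cases a)
  case (real r)
  then show ?thesis by (cases "r = 0") (auto simp: inverse_ennreal)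
qed auto

text \<open>Composed with inversion, the power becomes increasing and surjective on [0,\<infinity>],
  and a monotone function with open range is continuous. This covers the end points without separate
  limits.\<close>

lemma continuous_on_neg_pow:
  assumes "p < 0"
  shows "continuous_on UNIV (\<lambda>a. neg_pow a p)"
proof -
  let ?f = "\<lambda>a. neg_pow (inverse a) p"
  have "continuous_on UNIV ?f"
  proof (rule continuous_onI_mono)
    have "?f (inverse (neg_pow b (1 / p))) = b" for b
      using neg_pow_neg_pow[of "1 / p" b] assms by (simp add: ennreal_inverse_inverse)
    then have "range ?f = UNIV" by (rule surjI)
    then show "open (range ?f)" by simp
    show "?f x \<le> ?f y" if "x \<le> y" for x y
      using assms that by (intro neg_pow_antimono ennreal_inverse_antimono)
  qed
  then have "continuous_on UNIV (\<lambda>a. ?f (inverse a))"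
    by (rule continuous_on_compose2) (auto intro: continuous_intros)
  then show ?thesis by (simp add: ennreal_inverse_inverse)
qed

text \<open>The special case for zero arguments is absorbed: \<open>neg_pow\<close> sends 0 to
  \<infinity>, which makes the sum infinite and the mean 0.\<close>

lemma p_mean_eq_neg_pow:
  fixes p l :: real
  assumes "p < 0" "0 < l" "l < 1"
  shows "p_mean p a b l = neg_pow (ennreal (1 - l) * neg_pow a p + ennreal l * neg_pow b p) (1 / p)"
  using assms by (auto simp: p_mean_def neg_pow_def ennreal_mult_top ennreal_mult_eq_top_iff)

lemma p_mean_mono:
  fixes p l :: real
  assumes "p < 0" "0 < l" "l < 1" "a \<le> a'" "b \<le> b'"
  shows "p_mean p a b l \<le> p_mean p a' b' l"
  unfolding p_mean_eq_neg_pow[OF assms(1-3)] using assms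
  by (intro neg_pow_antimono add_mono mult_left_mono) auto

lemma p_mean_same:
  fixes p l :: real
  assumes "p < 0" "0 < l" "l < 1"
  shows "p_mean p a a l = a"
proof -
  have "ennreal (1 - l) * x + ennreal l * x = x" for x
  proof -
    have "ennreal (1 - l) * x + ennreal l * x = ennreal (1 - l + l) * x"
      using assms by (subst ennreal_plus) (auto simp: distrib_right)
    then show ?thesis by simp
  qed
  then show ?thesis
    by (simp add: p_mean_eq_neg_pow[OF assms] neg_pow_neg_pow assms)
qed

lemma min_le_p_mean:
  fixes p l :: real
  assumes "p < 0" "0 < l" "l < 1"
  shows "min a b \<le> p_mean p a b l"
  using p_mean_mono[OF assms, of "min a b" a "min a b" b] p_mean_same[OF assms, of "min a b"] by simp

lemma p_mean_cmult:
  fixes p l c :: real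
  assumes "p < 0" "0 < l" "l < 1" "0 < c"
  shows "p_mean p (ennreal c * a) (ennreal c * b) l = ennreal c * p_mean p a b l"
proof -
  have "ennreal (1 - l) * neg_pow (ennreal c * a) p + ennreal l * neg_pow (ennreal c * b) p =
    ennreal (c powr p) * (ennreal (1 - l) * neg_pow a p + ennreal l * neg_pow b p)"
    using assms by (simp add: neg_pow_cmult distrib_left mult.left_commute)
  moreover have "(c powr p) powr (1 / p) = c" using assms by (simp add: powr_powr)
  ultimately show ?thesis
    using assms by (simp add: p_mean_eq_neg_pow neg_pow_cmult)
qed

text \<open>Continuity includes the values 0 and \<infinity>, so truncations and approximations from
  below pass to the limit.\<close>

lemma tendsto_p_mean:
  fixes p l :: real
  assumes "p < 0" "0 < l" "l < 1" "(u \<longlongrightarrow> a) F" "(v \<longlongrightarrow> b) F"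
  shows "((\<lambda>n. p_mean p (u n) (v n) l) \<longlongrightarrow> p_mean p a b l) F"
proof -
  have *: "((\<lambda>n. neg_pow (w n) q) \<longlongrightarrow> neg_pow c q) F" if "q < 0" "(w \<longlongrightarrow> c) F" for w c q
    using continuous_on_tendsto_compose[OF continuous_on_neg_pow[OF that(1)] that(2)] by simp
  show ?thesis unfolding p_mean_eq_neg_pow[OF assms(1-3)]
    by (intro * tendsto_add tendsto_mult_ennreal tendsto_const) (use assms in auto)
qed

lemma p_mean_ennreal:
  fixes p l a b :: real
  assumes "p < 0" "0 < l" "l < 1" "0 < a" "0 < b"
  shows "p_mean p (ennreal a) (ennreal b) l =
    ennreal (((1 - l) * a powr p + l * b powr p) powr (1 / p))"
proof -
  define S where "S = (1 - l) * a powr p + l * b powr p"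
  have "0 < S" unfolding S_def using assms by (intro add_pos_pos mult_pos_pos) auto
  have "ennreal (1 - l) * neg_pow (ennreal a) p + ennreal l * neg_pow (ennreal b) p = ennreal S"
  proof -
    have "neg_pow (ennreal a) p = ennreal (a powr p)" "neg_pow (ennreal b) p = ennreal (b powr p)"
      using assms by (auto simp: neg_pow_def)
    then show ?thesis using assms unfolding S_def
      by (subst ennreal_plus) (auto simp: ennreal_mult)
  qed
  then show ?thesis
    using \<open>0 < S\<close> by (simp add: p_mean_eq_neg_pow[OF assms(1-3)] neg_pow_def flip: S_def)
qed

text \<open>This is the two-term Hoelder inequality with exponents \<open>1 / (1 + p)\<close> and \<open>- 1 / p\<close>.\<close>

lemma p_mean_mult_arith_mean_real:
  fixes p q l a b c d :: real
  assumes p: "- 1 < p" "p < 0" and q: "q = p / (p + 1)" and l: "0 < l" "l < 1"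
    and pos: "0 < a" "0 < b" "0 < c" "0 < d"
  shows "((1 - l) * (c * a) powr q + l * (d * b) powr q) powr (1 / q)
    \<le> ((1 - l) * c powr p + l * d powr p) powr (1 / p) * ((1 - l) * a + l * b)"
proof -
  define S where "S = (1 - l) * c powr p + l * d powr p"
  define T where "T = (1 - l) * a + l * b"
  define U where "U = (1 - l) * (c * a) powr q + l * (d * b) powr q"
  have STU: "0 < S" "0 < T" "0 < U"
    using l pos by (auto simp: S_def T_def U_def intro!: add_pos_pos)
  \<comment> \<open>This relation makes x cancel in the Young product: \<open>(z * x) powr q\<close>
    to the power \<open>1 + p\<close>, times \<open>x powr (- p)\<close>, is
    \<open>z powr p\<close>.\<close>
  have qp: "q * (1 + p) = p" unfolding q using p by (simp add: add.commute)
  have young: "z powr p \<le> U powr (1 + p) * T powr (- p) * ((1 + p) * ((z * x) powr q / U) + (- p) * (x / T))"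
    if "0 < z" "0 < x" for z x
  proof -
    have "((z * x) powr q / U) powr (1 + p) * (x / T) powr (- p) \<le> (1 + p) * ((z * x) powr q / U) + (- p) * (x / T)"
      using p STU that by (intro Youngs_inequality_0) auto
    moreover have "((z * x) powr q / U) powr (1 + p) * (x / T) powr (- p) = z powr p / (U powr (1 + p) * T powr (- p))"
      using that STU by (simp add: powr_divide powr_powr qp powr_mult powr_minus_divide powr_minus)
    ultimately have "z powr p / (U powr (1 + p) * T powr (- p))
        \<le> (1 + p) * ((z * x) powr q / U) + (- p) * (x / T)" by simp
    moreover have "0 < U powr (1 + p) * T powr (- p)" using STU by simp
    ultimately show ?thesis by (metis pos_divide_le_eq mult.commute)
  qed
  \<comment> \<open>Averaging the two instances of \<open>young\<close> with weights 1 - l and l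
    turns both normalised terms into \<open>U / U\<close> and \<open>T / T\<close>, and the weights
    \<open>1 + p\<close> and \<open>- p\<close> sum to one.\<close>
  have avg: "(1 - l) * (K * ((1 + p) * (X / U) + (- p) * (a / T))) + l * (K * ((1 + p) * (Y / U) + (- p) * (b / T))) =
    K * ((1 + p) * (((1 - l) * X + l * Y) / U) + (- p) * (((1 - l) * a + l * b) / T))" for K X Y
    by (simp add: add_divide_distrib diff_divide_distrib algebra_simps)
  have "S \<le> (1 - l) * (U powr (1 + p) * T powr (- p) * ((1 + p) * ((c * a) powr q / U) + (- p) * (a / T)))
      + l * (U powr (1 + p) * T powr (- p) * ((1 + p) * ((d * b) powr q / U) + (- p) * (b / T)))"
    unfolding S_def using l pos by (intro add_mono mult_left_mono young) auto
  also have "\<dots> = U powr (1 + p) * T powr (- p) * ((1 + p) * (U / U) + (- p) * (T / T))"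
    by (simp only: avg) (simp only: U_def T_def)
  also have "\<dots> = U powr (1 + p) * T powr (- p)" using STU by simp
  finally have "S \<le> U powr (1 + p) * T powr (- p)" .
  then have "(U powr (1 + p) * T powr (- p)) powr (1 / p) \<le> S powr (1 / p)"
    using STU p by (intro powr_mono2') auto
  moreover have "(U powr (1 + p) * T powr (- p)) powr (1 / p) = U powr (1 / q) / T"
  proof -
    have "1 / q = (1 + p) * (1 / p)" using p by (simp add: q)
    moreover have "T powr (- p * (1 / p)) = 1 / T" using p STU by (simp add: powr_minus_divide)
    ultimately show ?thesis using STU by (simp add: powr_mult powr_powr)
  qed
  ultimately have "U powr (1 / q) / T \<le> S powr (1 / p)" by (simp only:)
  then show ?thesis
    using STU unfolding S_def[symmetric] T_def[symmetric] U_def[symmetric] by (simp only: pos_divide_le_eq)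
qed

text \<open>Later c and d are the suprema of two functions, and a and b the integrals of these
  functions after scaling to supremum one; the lemma turns a linear inequality for the scaled
  functions into one with exponent q for the original ones.\<close>

lemma p_mean_mult_arith_mean:
  fixes p q l c d :: real
  assumes p: "- 1 < p" "p < 0" and q: "q = p / (p + 1)" and l: "0 < l" "l < 1" and pos: "0 < c" "0 < d"
  shows "p_mean q (ennreal c * a) (ennreal d * b) l
    \<le> p_mean p (ennreal c) (ennreal d) l * (ennreal (1 - l) * a + ennreal l * b)"
proof -
  have "q < 0" using p by (simp add: q divide_neg_pos)
  \<comment> \<open>If a or b is infinite, the right side is \<infinity> only because this factor
    does not vanish, as \<infinity> times 0 is 0.\<close>
  have pc: "p_mean p (ennreal c) (ennreal d) l \<noteq> 0"
  proof -
    have "0 < min c d" using pos by simp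
    then have "0 < min (ennreal c) (ennreal d)" by (simp add: pos)
    also have "\<dots> \<le> p_mean p (ennreal c) (ennreal d) l" by (rule min_le_p_mean) fact+
    finally show ?thesis by simp
  qed
  consider "a = 0 \<or> b = 0" | "a = \<infinity> \<or> b = \<infinity>" | x y where "a = ennreal x" "b = ennreal y" "0 < x" "0 < y"
    by (metis ennreal_cases ennreal_eq_0_iff infinity_ennreal_def not_le)
  then show ?thesis
  proof cases
    case 1
    then show ?thesis by (auto simp: p_mean_def)
  next
    case 2
    then have sum: "ennreal (1 - l) * a + ennreal l * b = top"
      using l by (auto simp: ennreal_mult_top)
    show ?thesis unfolding sum using pc by (simp add: ennreal_mult_top)
  next
    case 3
    then show ?thesis
      using p_mean_mult_arith_mean_real[OF p q l 3(3,4) pos] p l pos \<open>q < 0\<close>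
      by (simp add: p_mean_ennreal ennreal_leI flip: ennreal_mult ennreal_plus)
  qed
qed

section \<open>The Borell--Brascamp--Lieb inequality\<close>

text \<open>Scaling f and g to supremum one brings them under \<open>one_dim_min_inequality\<close>,
  which gives a linear inequality; the Hoelder-type lemma above undoes the scaling at the price of
  passing from p to q.\<close>

lemma borell_brascamp_lieb_real_bounded:
  fixes f g h :: "real \<Rightarrow> ennreal" and p q l :: real
  assumes [measurable]: "f \<in> borel_measurable borel" "g \<in> borel_measurable borel"
      "h \<in> borel_measurable borel"
    and p: "- 1 < p" "p < 0" and q: "q = p / (p + 1)" and l: "0 < l" "l < 1"
    and fin: "(SUP x. f x) \<noteq> \<infinity>" "(SUP x. g x) \<noteq> \<infinity>"
    and h: "\<And>x y. p_mean p (f x) (g y) l \<le> h ((1 - l) * x + l * y)"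
  shows "p_mean q (\<integral>\<^sup>+x. f x \<partial>lborel) (\<integral>\<^sup>+x. g x \<partial>lborel) l \<le> (\<integral>\<^sup>+x. h x \<partial>lborel)"
proof (cases "(SUP x. f x) = 0 \<or> (SUP x. g x) = 0")
  case True
  then have "(\<forall>x. f x = 0) \<or> (\<forall>x. g x = 0)"
    by (metis SUP_upper UNIV_I le_zero_eq)
  then have "(\<integral>\<^sup>+x. f x \<partial>lborel) = 0 \<or> (\<integral>\<^sup>+x. g x \<partial>lborel) = 0"
    by (auto simp: nn_integral_0_iff_AE)
  then show ?thesis by (auto simp: p_mean_def)
next
  case False
  then obtain A B where A: "(SUP x. f x) = ennreal A" "0 < A" and B: "(SUP x. g x) = ennreal B" "0 < B"
    using fin by (metis ennreal_cases ennreal_eq_0_iff infinity_ennreal_def not_le)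
  \<comment> \<open>The scale of h is the p-mean of the two suprema: by homogeneity,
    \<open>A * m\<close> and \<open>B * m\<close> have p-mean \<open>c * m\<close>.\<close>
  define c where "c = ((1 - l) * A powr p + l * B powr p) powr (1 / p)"
  have c: "p_mean p (ennreal A) (ennreal B) l = ennreal c"
    unfolding c_def using p l A(2) B(2) by (intro p_mean_ennreal)
  have "0 < (1 - l) * A powr p + l * B powr p"
    using l A(2) B(2) by (intro add_pos_pos mult_pos_pos) auto
  then have "0 < c" unfolding c_def by simp
  have cancel: "ennreal (1 / r) * (ennreal r * a) = a" "ennreal r * (ennreal (1 / r) * a) = a"
    if "0 < r" for r a
    using that by (simp_all add: mult.assoc[symmetric] ennreal_mult[symmetric])
  define F G X where "F x = ennreal (1 / A) * f x" and "G x = ennreal (1 / B) * g x"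
    and "X x = ennreal (1 / c) * h x" for x
  have [measurable]: "F \<in> borel_measurable borel" "G \<in> borel_measurable borel" "X \<in> borel_measurable borel"
    unfolding F_def G_def X_def by measurable
  have sup: "(SUP x. F x) = 1" "(SUP x. G x) = 1"
    using A B cancel(1)[of _ 1] by (simp_all add: F_def G_def flip: SUP_mult_left_ennreal)
  have "min (F x) (G y) \<le> X ((1 - l) * x + l * y)" for x y
  proof -
    define m where "m = min (F x) (G y)"
    have "F x \<le> 1" using sup(1) by (metis SUP_upper UNIV_I)
    then have "m \<noteq> \<infinity>" unfolding m_def by (auto simp: min_def top_unique)
    have "m * ennreal c = p_mean p (ennreal A * m) (ennreal B * m) l"
    proof (cases "m = 0")
      case False
      with \<open>m \<noteq> \<infinity>\<close> obtain t where t: "m = ennreal t" "0 < t"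
        by (metis ennreal_cases ennreal_eq_0_iff infinity_ennreal_def not_le)
      then show ?thesis
        using p_mean_cmult[OF p(2) l t(2), of "ennreal A" "ennreal B"] by (simp add: c mult.commute)
    qed (simp add: p_mean_def)
    also have "\<dots> \<le> p_mean p (ennreal A * F x) (ennreal B * G y) l"
      using p l by (intro p_mean_mono mult_left_mono) (auto simp: m_def)
    also have "\<dots> \<le> h ((1 - l) * x + l * y)"
      using h[of x y] A B by (simp add: F_def G_def cancel)
    finally have "ennreal (1 / c) * (ennreal c * m) \<le> X ((1 - l) * x + l * y)"
      unfolding X_def by (intro mult_left_mono) (simp_all add: mult.commute)
    then show ?thesis using \<open>0 < c\<close> by (simp add: cancel m_def)
  qed
  with sup have "ennreal (1 - l) * (\<integral>\<^sup>+x. F x \<partial>lborel) + ennreal l * (\<integral>\<^sup>+x. G x \<partial>lborel)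
    \<le> (\<integral>\<^sup>+x. X x \<partial>lborel)"
    using l by (intro one_dim_min_inequality) auto
  then have "ennreal c * (ennreal (1 - l) * (\<integral>\<^sup>+x. F x \<partial>lborel) + ennreal l * (\<integral>\<^sup>+x. G x \<partial>lborel))
    \<le> ennreal c * (\<integral>\<^sup>+x. X x \<partial>lborel)"
    by (rule mult_left_mono) simp
  also have "\<dots> = (\<integral>\<^sup>+x. h x \<partial>lborel)"
    using \<open>0 < c\<close> by (simp add: X_def nn_integral_cmult cancel)
  finally have le: "ennreal c * (ennreal (1 - l) * (\<integral>\<^sup>+x. F x \<partial>lborel) + ennreal l * (\<integral>\<^sup>+x. G x \<partial>lborel))
    \<le> (\<integral>\<^sup>+x. h x \<partial>lborel)" .
  have "p_mean q (\<integral>\<^sup>+x. f x \<partial>lborel) (\<integral>\<^sup>+x. g x \<partial>lborel) l =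
      p_mean q (ennreal A * (\<integral>\<^sup>+x. F x \<partial>lborel)) (ennreal B * (\<integral>\<^sup>+x. G x \<partial>lborel)) l"
    using A B by (simp add: F_def G_def nn_integral_cmult cancel)
  also have "\<dots> \<le> ennreal c * (ennreal (1 - l) * (\<integral>\<^sup>+x. F x \<partial>lborel) + ennreal l * (\<integral>\<^sup>+x. G x \<partial>lborel))"
    unfolding c[symmetric] using p q l A(2) B(2) by (intro p_mean_mult_arith_mean)
  also note le
  finally show ?thesis .
qed

text \<open>Truncation at height N gives finite suprema and keeps the hypothesis, since means are
  monotone. Monotone convergence and continuity of the mean remove it.\<close>

lemma borell_brascamp_lieb_real:
  fixes f g h :: "real \<Rightarrow> ennreal" and p q l :: real
  assumes [measurable]: "f \<in> borel_measurable borel" "g \<in> borel_measurable borel"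
      "h \<in> borel_measurable borel"
    and p: "- 1 < p" "p < 0" and q: "q = p / (p + 1)" and l: "0 < l" "l < 1"
    and h: "\<And>x y. p_mean p (f x) (g y) l \<le> h ((1 - l) * x + l * y)"
  shows "p_mean q (\<integral>\<^sup>+x. f x \<partial>lborel) (\<integral>\<^sup>+x. g x \<partial>lborel) l \<le> (\<integral>\<^sup>+x. h x \<partial>lborel)"
proof -
  define T where "T u N x = min (u x) (ennreal (real N))" for u :: "real \<Rightarrow> ennreal" and N x
  have T_le: "T u N x \<le> u x" for u N x by (simp add: T_def)
  have T_fin: "(SUP x. T u N x) \<noteq> \<infinity>" for u N
  proof -
    have "(SUP x. T u N x) \<le> ennreal (real N)" by (intro SUP_least) (simp add: T_def)
    also have "\<dots> < \<infinity>" by simp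
    finally show ?thesis by (rule less_imp_neq)
  qed
  have T_meas [measurable]: "T u N \<in> borel_measurable borel" if [measurable]: "u \<in> borel_measurable borel" for u N
    unfolding T_def by measurable
  have lim: "(\<lambda>N. \<integral>\<^sup>+x. T u N x \<partial>lborel) \<longlonglongrightarrow> (\<integral>\<^sup>+x. u x \<partial>lborel)"
    if [measurable]: "u \<in> borel_measurable borel" for u
  proof -
    have mono: "incseq (\<lambda>N. T u N)"
      by (auto simp: incseq_def le_fun_def T_def min_le_iff_disj intro: ennreal_leI)
    have "(SUP N. T u N x) = u x" for x
    proof (rule antisym[OF SUP_least[OF T_le]])
      show "u x \<le> (SUP N. T u N x)"
      proof (cases "u x")
        case (real r)
        obtain N where "r \<le> real N" using real_arch_simple by blast
        then have "T u N x = u x" using real by (simp add: T_def min_def ennreal_leI)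
        then show ?thesis by (metis SUP_upper UNIV_I)
      next
        case top
        then have "T u N x = of_nat N" for N by (simp add: T_def ennreal_of_nat_eq_real_of_nat)
        then show ?thesis by (simp only: ennreal_SUP_of_nat_eq_top top_greatest)
      qed
    qed
    then have "(\<integral>\<^sup>+x. u x \<partial>lborel) = (SUP N. \<integral>\<^sup>+x. T u N x \<partial>lborel)"
      using nn_integral_monotone_convergence_SUP[OF mono, of lborel] by simp
    moreover have "incseq (\<lambda>N. \<integral>\<^sup>+x. T u N x \<partial>lborel)"
      using mono by (auto simp: incseq_def le_fun_def intro!: nn_integral_mono)
    ultimately show ?thesis by (simp add: LIMSEQ_SUP)
  qed
  have "q < 0" using p by (simp add: q divide_neg_pos)
  have "p_mean q (\<integral>\<^sup>+x. T f N x \<partial>lborel) (\<integral>\<^sup>+x. T g N x \<partial>lborel) l \<le> (\<integral>\<^sup>+x. h x \<partial>lborel)" for N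
  proof (rule borell_brascamp_lieb_real_bounded[OF _ _ _ p q l T_fin T_fin])
    show "p_mean p (T f N x) (T g N y) l \<le> h ((1 - l) * x + l * y)" for x y
      by (rule order_trans[OF p_mean_mono[OF p(2) l T_le T_le] h])
  qed measurable
  moreover have "(\<lambda>N. p_mean q (\<integral>\<^sup>+x. T f N x \<partial>lborel) (\<integral>\<^sup>+x. T g N x \<partial>lborel) l)
      \<longlonglongrightarrow> p_mean q (\<integral>\<^sup>+x. f x \<partial>lborel) (\<integral>\<^sup>+x. g x \<partial>lborel) l"
    by (intro tendsto_p_mean lim \<open>q < 0\<close> l) measurable
  ultimately show ?thesis by (intro LIMSEQ_le_const2) auto
qed

text \<open>Induction on the coordinates: integrating one out by the one-dimensional inequality
  changes p to q with -1/q = -1/p - 1, which matches the drop of \<open>card I\<close>. The minimum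
  is taken only at the end, where the mean still has a negative exponent. Points are extensional
  because these form the space of the product measure.\<close>

lemma borell_brascamp_lieb_PiM:
  fixes f g h :: "('i \<Rightarrow> real) \<Rightarrow> ennreal" and p l :: real
  assumes "finite I"
    and "f \<in> borel_measurable (\<Pi>\<^sub>M i\<in>I. lborel)" "g \<in> borel_measurable (\<Pi>\<^sub>M i\<in>I. lborel)"
      "h \<in> borel_measurable (\<Pi>\<^sub>M i\<in>I. lborel)"
    and "p < 0" "real (card I) < - 1 / p" and l: "0 < l" "l < 1"
    and "\<And>x y. x \<in> extensional I \<Longrightarrow> y \<in> extensional I \<Longrightarrow>
      p_mean p (f x) (g y) l \<le> h (\<lambda>i\<in>I. (1 - l) * x i + l * y i)"
  shows "min (\<integral>\<^sup>+x. f x \<partial>(\<Pi>\<^sub>M i\<in>I. lborel)) (\<integral>\<^sup>+x. g x \<partial>(\<Pi>\<^sub>M i\<in>I. lborel))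
    \<le> (\<integral>\<^sup>+x. h x \<partial>(\<Pi>\<^sub>M i\<in>I. lborel))"
  using assms(1-6) assms(9)
proof (induction I arbitrary: f g h p rule: finite_induct)
  case empty
  \<comment> \<open>The empty product is a unit mass at this single function.\<close>
  have "min (f (\<lambda>_. undefined)) (g (\<lambda>_. undefined)) \<le> p_mean p (f (\<lambda>_. undefined)) (g (\<lambda>_. undefined)) l"
    using empty.prems l by (intro min_le_p_mean) auto
  also have "\<dots> \<le> h (\<lambda>_. undefined)"
    using empty.prems(6)[of "\<lambda>_. undefined" "\<lambda>_. undefined"] by simp
  finally show ?case by (simp add: nn_integral_empty space_PiM_empty PiM_empty nn_integral_count_space_finite)
next
  case (insert j I)
  interpret product_sigma_finite "\<lambda>_::'i. lborel :: real measure" ..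
  let ?P = "\<Pi>\<^sub>M i\<in>I. (lborel :: real measure)"
  note [measurable] = insert.prems(1-3)
  have "0 < - 1 / p" using insert.prems(4) by simp
  have "1 \<le> real (card (insert j I))" using insert.hyps by simp
  \<comment> \<open>Strictness here keeps p above -1, so that q is finite and the exponent
    -\<infinity> never occurs.\<close>
  then have "1 < - 1 / p" using insert.prems(5) by linarith
  then have p: "- 1 < p" "p < 0" using insert.prems(4) by (auto simp: field_simps)
  define q where "q = p / (p + 1)"
  have q: "q < 0" "- 1 / q = - 1 / p - 1" using p by (auto simp: q_def divide_neg_pos field_simps)
  define S where "S u x = (\<integral>\<^sup>+s. u (x(j := s)) \<partial>lborel)" for u :: "('i \<Rightarrow> real) \<Rightarrow> ennreal" and x
  have upd [measurable]: "(\<lambda>s. x(j := s)) \<in> borel \<rightarrow>\<^sub>M (\<Pi>\<^sub>M i\<in>insert j I. lborel)" if "x \<in> extensional I" for x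
  proof -
    have "(\<lambda>s. x(j := s)) \<in> lborel \<rightarrow>\<^sub>M (\<Pi>\<^sub>M i\<in>insert j I. lborel)"
      using that insert.hyps by (intro measurable_component_update) (auto simp: space_PiM PiE_def)
    then show ?thesis by simp
  qed
  have S_meas: "S u \<in> borel_measurable ?P" if [measurable]: "u \<in> borel_measurable (\<Pi>\<^sub>M i\<in>insert j I. lborel)" for u
    unfolding S_def by measurable
  have S_eq: "(\<integral>\<^sup>+x. u x \<partial>(\<Pi>\<^sub>M i\<in>insert j I. lborel)) = (\<integral>\<^sup>+x. S u x \<partial>?P)"
    if "u \<in> borel_measurable (\<Pi>\<^sub>M i\<in>insert j I. lborel)" for u
    unfolding S_def using insert.hyps that by (intro product_nn_integral_insert)
  have "min (\<integral>\<^sup>+x. S f x \<partial>?P) (\<integral>\<^sup>+x. S g x \<partial>?P) \<le> (\<integral>\<^sup>+x. S h x \<partial>?P)"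
  proof (rule insert.IH[of _ _ _ q])
    show "real (card I) < - 1 / q" using insert.prems(5) insert.hyps q by simp
    fix x y :: "'i \<Rightarrow> real" assume xy: "x \<in> extensional I" "y \<in> extensional I"
    let ?z = "\<lambda>i\<in>I. (1 - l) * x i + l * y i"
    note [measurable] = upd[OF xy(1)] upd[OF xy(2)] upd[OF restrict_extensional]
    show "p_mean q (S f x) (S g y) l \<le> S h ?z"
      unfolding S_def
    proof (rule borell_brascamp_lieb_real[OF _ _ _ p q_def l])
      fix s t
      have "p_mean p (f (x(j := s))) (g (y(j := t))) l
        \<le> h (\<lambda>i\<in>insert j I. (1 - l) * (x(j := s)) i + l * (y(j := t)) i)"
        using xy by (intro insert.prems(6)) (auto simp: extensional_def)
      also have "(\<lambda>i\<in>insert j I. (1 - l) * (x(j := s)) i + l * (y(j := t)) i) = ?z(j := (1 - l) * s + l * t)"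
        using insert.hyps by (auto simp: fun_eq_iff)
      finally show "p_mean p (f (x(j := s))) (g (y(j := t))) l \<le> h (?z(j := (1 - l) * s + l * t))" .
    qed measurable
  qed (use S_meas q in auto)
  then show ?case by (simp add: S_eq)
qed

section \<open>Rearrangement of fibres\<close>

lemma nn_integral_ennreal_levels_le:
  "(\<integral>\<^sup>+t. indicator {t. 0 < t \<and> ennreal t \<le> a} t \<partial>lborel) = a"
proof -
  have "(\<integral>\<^sup>+t. indicator {t. 0 < t \<and> ennreal t \<le> a} t \<partial>lborel) =
    (\<integral>\<^sup>+t. indicator {t. 0 < t \<and> ennreal t < a} t \<partial>lborel)"
    using AE_lborel_singleton[of "enn2real a"]
    by (intro nn_integral_cong_AE, eventually_elim) (auto simp: indicator_def order_less_le)
  then show ?thesis by (simp add: nn_integral_ennreal_levels)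
qed

text \<open>The distribution function of u.\<close>

definition level_length :: "(real \<Rightarrow> ennreal) \<Rightarrow> real \<Rightarrow> ennreal" where
  "level_length u t = emeasure lborel {s. ennreal t < u s}"

text \<open>For measurable u this is the decreasing rearrangement. The levels counted form an
  interval starting at 0, so its length is the generalised inverse of the distribution function.
  Written as an integral, it is measurable in parameters and open to Fubini. Only a > 0 is
  meaningful: for a \<le> 0 every level counts and the value is \<infinity>.\<close>

definition rearrangement :: "(real \<Rightarrow> ennreal) \<Rightarrow> real \<Rightarrow> ennreal" where
  "rearrangement u a = (\<integral>\<^sup>+t. indicator {t. 0 < t \<and> ennreal a \<le> level_length u t} t \<partial>lborel)"

lemma level_length_antimono:
  assumes [measurable]: "u \<in> borel_measurable borel" and "t \<le> t'"
  shows "level_length u t' \<le> level_length u t"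
  unfolding level_length_def
  by (intro emeasure_mono) (auto intro: le_less_trans[OF ennreal_leI[OF assms(2)]])

text \<open>If t failed the test, then by monotonicity all levels passing it would lie below t, and
  their total length would be at most t.\<close>

lemma level_length_ge_of_less_rearrangement:
  assumes "u \<in> borel_measurable borel" "0 < t" "ennreal t < rearrangement u a"
  shows "ennreal a \<le> level_length u t"
proof (rule ccontr)
  assume not: "\<not> ennreal a \<le> level_length u t"
  have "t' < t" if "ennreal a \<le> level_length u t'" for t'
    using not that level_length_antimono[OF assms(1), of t t'] by (meson leI order_trans)
  then have "rearrangement u a \<le> (\<integral>\<^sup>+t'. indicator {0<..<t} t' \<partial>lborel)"
    unfolding rearrangement_def by (intro nn_integral_mono) (auto simp: indicator_def)
  also have "\<dots> = ennreal t" using assms(2) by simp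
  finally show False using assms(3) by simp
qed

lemma le_rearrangementI:
  assumes "\<And>t. 0 < t \<Longrightarrow> ennreal t < m \<Longrightarrow> ennreal a \<le> level_length u t"
  shows "m \<le> rearrangement u a"
proof -
  have "m = (\<integral>\<^sup>+t. indicator {t. 0 < t \<and> ennreal t < m} t \<partial>lborel)"
    by (simp add: nn_integral_ennreal_levels)
  also have "\<dots> \<le> rearrangement u a"
    unfolding rearrangement_def using assms by (intro nn_integral_mono) (auto simp: indicator_def)
  finally show ?thesis .
qed

lemma rearrangement_le_SUP:
  assumes "0 < a"
  shows "rearrangement u a \<le> (SUP s. u s)"
proof -
  have "ennreal t < (SUP s. u s)" if "ennreal a \<le> level_length u t" for t
  proof -
    have "{s. ennreal t < u s} \<noteq> {}"
      using that assms unfolding level_length_def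
      by (metis emeasure_empty ennreal_eq_0_iff le_zero_eq not_le)
    then show ?thesis by (auto simp: less_SUP_iff)
  qed
  then have "rearrangement u a \<le> (\<integral>\<^sup>+t. indicator {t. 0 < t \<and> ennreal t < (SUP s. u s)} t \<partial>lborel)"
    unfolding rearrangement_def by (intro nn_integral_mono) (auto simp: indicator_def)
  then show ?thesis by (simp only: nn_integral_ennreal_levels)
qed

lemma measurable_level_length:
  assumes [measurable]: "case_prod u \<in> borel_measurable (M \<Otimes>\<^sub>M borel)"
  shows "(\<lambda>(x, t). level_length (u x) t) \<in> borel_measurable (M \<Otimes>\<^sub>M borel)"
proof -
  have "{y \<in> space ((M \<Otimes>\<^sub>M borel) \<Otimes>\<^sub>M lborel). ennreal (snd (fst y)) < u (fst (fst y)) (snd y)}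
    \<in> sets ((M \<Otimes>\<^sub>M borel) \<Otimes>\<^sub>M (lborel :: real measure))"
    by measurable
  from lborel.measurable_emeasure_Pair[OF this]
  show ?thesis
    by (rule measurable_cong[THEN iffD1, rotated])
      (auto simp: level_length_def space_pair_measure intro!: arg_cong[where f = "emeasure lborel"])
qed

lemma measurable_rearrangement:
  assumes "case_prod u \<in> borel_measurable (M \<Otimes>\<^sub>M borel)"
  shows "(\<lambda>(x, a). rearrangement (u x) a) \<in> borel_measurable (M \<Otimes>\<^sub>M borel)"
proof -
  note measurable_level_length[OF assms, measurable]
  have "(\<lambda>xa. \<integral>\<^sup>+t. indicator {t. 0 < t \<and> ennreal (snd xa) \<le> level_length (u (fst xa)) t} t \<partial>lborel)
    \<in> borel_measurable (M \<Otimes>\<^sub>M borel)"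
    by measurable
  then show ?thesis by (simp add: rearrangement_def case_prod_beta')
qed

lemma measurable_rearrangement_at:
  assumes "case_prod u \<in> borel_measurable (M \<Otimes>\<^sub>M borel)"
  shows "(\<lambda>x. rearrangement (u x) a) \<in> borel_measurable M"
  using measurable_compose[OF _ measurable_rearrangement[OF assms], of "\<lambda>x. (x, a)" M] by simp

text \<open>Both sides measure the region of pairs (a, t) with
  \<open>ennreal a \<le> level_length u t\<close>: slices at fixed a give the rearrangement, slices
  at fixed t the distribution function.\<close>

lemma nn_integral_rearrangement:
  assumes [measurable]: "u \<in> borel_measurable borel"
  shows "(\<integral>\<^sup>+a. indicator {0<..} a * rearrangement u a \<partial>lborel) = (\<integral>\<^sup>+s. u s \<partial>lborel)"
proof -
  have [measurable]: "level_length u \<in> borel_measurable borel"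
    unfolding level_length_def by measurable
  have "(\<integral>\<^sup>+a. indicator {0<..} a * rearrangement u a \<partial>lborel) =
    (\<integral>\<^sup>+a. (\<integral>\<^sup>+t. indicator {0<..} a * indicator {t. 0 < t \<and> ennreal a \<le> level_length u t} t \<partial>lborel) \<partial>lborel)"
    unfolding rearrangement_def by (intro nn_integral_cong nn_integral_cmult[symmetric]) measurable
  also have "\<dots> =
    (\<integral>\<^sup>+t. (\<integral>\<^sup>+a. indicator {0<..} a * indicator {t. 0 < t \<and> ennreal a \<le> level_length u t} t \<partial>lborel) \<partial>lborel)"
    by (rule lborel_pair.Fubini') measurable
  also have "\<dots> =
    (\<integral>\<^sup>+t. (\<integral>\<^sup>+a. indicator {0<..} t * indicator {a. 0 < a \<and> ennreal a \<le> level_length u t} a \<partial>lborel) \<partial>lborel)"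
    by (intro nn_integral_cong) (auto simp: indicator_def)
  also have "\<dots> = (\<integral>\<^sup>+t. indicator {0<..} t * level_length u t \<partial>lborel)"
    by (subst nn_integral_cmult) (auto simp: nn_integral_ennreal_levels_le)
  also have "\<dots> = (\<integral>\<^sup>+s. u s \<partial>lborel)"
    unfolding level_length_def
    using nn_integral_layer_cake[OF lborel.sigma_finite_measure_axioms, of u] by simp
  finally show ?thesis .
qed

text \<open>For \<open>a > 0\<close> the rearrangement at \<open>a\<close> of a Borel minorant of \<open>f\<close> qualifies; for \<open>a = 0\<close> so does
  every minorant of the projection, which is why no measurability of the projection is needed.\<close>

definition fills :: "'i set \<Rightarrow> (('i \<Rightarrow> real) \<Rightarrow> real \<Rightarrow> ennreal) \<Rightarrow> (('i \<Rightarrow> real) \<Rightarrow> ennreal) \<Rightarrow> real \<Rightarrow> bool" where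
  "fills I f \<phi> a \<longleftrightarrow> (\<forall>x\<in>extensional I. \<forall>t>0. ennreal t < \<phi> x \<longrightarrow>
     (\<exists>E\<in>sets borel. E \<noteq> {} \<and> (\<forall>s\<in>E. ennreal t < f x s) \<and> ennreal a \<le> emeasure lborel E))"

lemma section_measurable_PiM:
  assumes "case_prod u \<in> borel_measurable ((\<Pi>\<^sub>M i\<in>I. lborel) \<Otimes>\<^sub>M borel)" "x \<in> extensional I"
  shows "u x \<in> borel_measurable borel"
  using measurable_Pair2[OF assms(1), of x] assms(2) by (simp add: space_PiM PiE_def)

text \<open>Sets supplied by \<open>fills\<close> over x and y combine, by Brunn--Minkowski on the
  line, inside a level set of h over the combined point. This bounds the rearrangement of h below by
  a p-mean, and Borell--Brascamp--Lieb integrates that bound. The sets must be nonempty even for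
  length 0, since Brunn--Minkowski fails for empty sets.\<close>

lemma fills_inequality:
  fixes f g h :: "('i \<Rightarrow> real) \<Rightarrow> real \<Rightarrow> ennreal" and p l a b :: real and I :: "'i set"
  defines "P \<equiv> (\<Pi>\<^sub>M i\<in>I. (lborel :: real measure))"
  assumes "finite I" and h_meas: "case_prod h \<in> borel_measurable (P \<Otimes>\<^sub>M borel)"
    and \<phi>\<psi>: "\<phi> \<in> borel_measurable P" "\<psi> \<in> borel_measurable P"
    and p: "p < 0" "real (card I) < - 1 / p" and l: "0 < l" "l < 1"
    and h: "\<And>x y s t. x \<in> extensional I \<Longrightarrow> y \<in> extensional I \<Longrightarrow>
      p_mean p (f x s) (g y t) l \<le> h (\<lambda>i\<in>I. (1 - l) * x i + l * y i) ((1 - l) * s + l * t)"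
    and fills: "fills I f \<phi> a" "fills I g \<psi> b" and ab: "0 \<le> a" "0 \<le> b"
  shows "min (\<integral>\<^sup>+x. \<phi> x \<partial>P) (\<integral>\<^sup>+x. \<psi> x \<partial>P) \<le> (\<integral>\<^sup>+x. rearrangement (h x) ((1 - l) * a + l * b) \<partial>P)"
  unfolding P_def
proof (rule borell_brascamp_lieb_PiM[OF \<open>finite I\<close> \<phi>\<psi>[unfolded P_def] _ p l])
  let ?c = "(1 - l) * a + l * b"
  show "(\<lambda>x. rearrangement (h x) ?c) \<in> borel_measurable (\<Pi>\<^sub>M i\<in>I. lborel)"
    using h_meas unfolding P_def by (rule measurable_rearrangement_at)
  fix x y :: "'i \<Rightarrow> real" assume xy: "x \<in> extensional I" "y \<in> extensional I"
  let ?z = "\<lambda>i\<in>I. (1 - l) * x i + l * y i"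
  have [measurable]: "h ?z \<in> borel_measurable borel"
    by (rule section_measurable_PiM[OF h_meas[unfolded P_def] restrict_extensional])
  show "p_mean p (\<phi> x) (\<psi> y) l \<le> rearrangement (h ?z) ?c"
  proof (rule le_rearrangementI)
    fix t :: real assume t: "0 < t" "ennreal t < p_mean p (\<phi> x) (\<psi> y) l"
    then have "0 < \<phi> x" "0 < \<psi> y" by (auto simp: p_mean_def zero_less_iff_neq_zero)
    \<comment> \<open>\<open>fills\<close> supplies sets only at finite levels strictly below \<phi>
      and \<psi>; continuity of the mean finds such levels whose mean still exceeds t.\<close>
    then obtain u v where u: "\<And>n. u n < \<phi> x" "u \<longlonglongrightarrow> \<phi> x" and v: "\<And>n. v n < \<psi> y" "v \<longlonglongrightarrow> \<psi> y"
      using approx_from_below_dense_linorder by metis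
    have "\<forall>\<^sub>F n in sequentially. ennreal t < p_mean p (u n) (v n) l"
      using tendsto_p_mean[OF p(1) l u(2) v(2)] t(2) by (rule order_tendstoD)
    then obtain n where n: "ennreal t < p_mean p (u n) (v n) l"
      using eventually_happens'[OF sequentially_bot] by blast
    then have "u n \<noteq> 0" "v n \<noteq> 0" by (auto simp: p_mean_def)
    moreover have "u n \<noteq> top" "v n \<noteq> top" using u(1)[of n] v(1)[of n] by auto
    ultimately obtain r r' where r: "u n = ennreal r" "0 < r" and r': "v n = ennreal r'" "0 < r'"
      by (metis ennreal_cases ennreal_eq_0_iff not_le)
    have "\<exists>E\<in>sets borel. E \<noteq> {} \<and> (\<forall>s\<in>E. ennreal r < f x s) \<and> ennreal a \<le> emeasure lborel E"
      using fills(1)[unfolded fills_def, rule_format, OF xy(1) r(2)] u(1)[of n] r(1) by simp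
    then obtain E where E: "E \<in> sets borel" "E \<noteq> {}" "\<And>s. s \<in> E \<Longrightarrow> ennreal r < f x s" "ennreal a \<le> emeasure lborel E"
      by blast
    have "\<exists>E\<in>sets borel. E \<noteq> {} \<and> (\<forall>s\<in>E. ennreal r' < g y s) \<and> ennreal b \<le> emeasure lborel E"
      using fills(2)[unfolded fills_def, rule_format, OF xy(2) r'(2)] v(1)[of n] r'(1) by simp
    then obtain E' where E': "E' \<in> sets borel" "E' \<noteq> {}" "\<And>s. s \<in> E' \<Longrightarrow> ennreal r' < g y s" "ennreal b \<le> emeasure lborel E'"
      by blast
    have "ennreal ?c = ennreal (1 - l) * ennreal a + ennreal l * ennreal b"
      using l ab by (simp add: ennreal_plus ennreal_mult)
    also have "\<dots> \<le> ennreal (1 - l) * emeasure lborel E + ennreal l * emeasure lborel E'"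
      using E(4) E'(4) by (intro add_mono mult_left_mono) auto
    also have "\<dots> \<le> level_length (h ?z) t"
      unfolding level_length_def
    proof (rule brunn_minkowski_real_convex[OF E(1) E'(1) _ E(2) E'(2) l])
      fix e e' assume "e \<in> E" "e' \<in> E'"
      have "ennreal t < p_mean p (ennreal r) (ennreal r') l" using n r r' by simp
      also have "\<dots> \<le> p_mean p (f x e) (g y e') l"
        using E(3)[OF \<open>e \<in> E\<close>] E'(3)[OF \<open>e' \<in> E'\<close>] by (intro p_mean_mono[OF p(1) l] less_imp_le)
      also have "\<dots> \<le> h ?z ((1 - l) * e + l * e')" by (rule h[OF xy])
      finally show "(1 - l) * e + l * e' \<in> {s. ennreal t < h ?z s}" by simp
    qed measurable
    finally show "ennreal ?c \<le> level_length (h ?z) t" .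
  qed
qed

lemma fills_rearrangement:
  assumes "case_prod u \<in> borel_measurable ((\<Pi>\<^sub>M i\<in>I. lborel) \<Otimes>\<^sub>M borel)"
    and le: "\<And>x s. x \<in> extensional I \<Longrightarrow> u x s \<le> f x s" and "0 < a"
  shows "fills I f (\<lambda>x. rearrangement (u x) a) a"
  unfolding fills_def
proof (intro ballI allI impI)
  fix x t assume x: "x \<in> extensional I" and t: "0 < t" "ennreal t < rearrangement (u x) a"
  note [measurable] = section_measurable_PiM[OF assms(1) x]
  let ?E = "{s. ennreal t < u x s}"
  have len: "ennreal a \<le> emeasure lborel ?E"
    using level_length_ge_of_less_rearrangement[OF _ t] by (simp add: level_length_def)
  then have "?E \<noteq> {}" using \<open>0 < a\<close> by (metis emeasure_empty ennreal_eq_0_iff le_zero_eq not_le)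
  then show "\<exists>E\<in>sets borel. E \<noteq> {} \<and> (\<forall>s\<in>E. ennreal t < f x s) \<and> ennreal a \<le> emeasure lborel E"
    using len le[OF x] by (intro bexI[of _ ?E]) (auto intro: less_le_trans)
qed

text \<open>At a = 0 no length is required, so one point where the fibre exceeds t serves as the
  set.\<close>

lemma fills_projection:
  assumes "\<And>x. x \<in> extensional I \<Longrightarrow> \<phi> x \<le> (SUP s. f x s)"
  shows "fills I f \<phi> 0"
  unfolding fills_def
proof (intro ballI allI impI)
  fix x :: "'a \<Rightarrow> real" and t :: real assume "x \<in> extensional I" "ennreal t < \<phi> x"
  with assms have "ennreal t < (SUP s. f x s)" by (meson less_le_trans)
  then obtain s where "ennreal t < f x s" by (auto simp: less_SUP_iff)
  then show "\<exists>E\<in>sets borel. E \<noteq> {} \<and> (\<forall>s\<in>E. ennreal t < f x s) \<and> ennreal 0 \<le> emeasure lborel E"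
    by (intro bexI[of _ "{s}"]) auto
qed

section \<open>Integrals of the rearranged fibres as a function of one variable\<close>

text \<open>The value at the single point 0 does not affect the integral but does decide the
  supremum. It is a parameter because it has to come from the projection of the original function,
  whereas u is only a Borel minorant.\<close>

definition section_profile ::
    "('i \<Rightarrow> real) measure \<Rightarrow> ennreal \<Rightarrow> (('i \<Rightarrow> real) \<Rightarrow> real \<Rightarrow> ennreal) \<Rightarrow> real \<Rightarrow> ennreal" where
  "section_profile P L u a =
     (if a < 0 then 0 else if a = 0 then L else \<integral>\<^sup>+x. rearrangement (u x) a \<partial>P)"

lemma section_profile:
  fixes u :: "('i \<Rightarrow> real) \<Rightarrow> real \<Rightarrow> ennreal" and I :: "'i set"
  defines "P \<equiv> (\<Pi>\<^sub>M i\<in>I. (lborel :: real measure))"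
  assumes "finite I" and u: "case_prod u \<in> borel_measurable (P \<Otimes>\<^sub>M borel)"
  shows measurable_section_profile: "section_profile P L u \<in> borel_measurable borel"
    and nn_integral_section_profile:
      "(\<integral>\<^sup>+a. section_profile P L u a \<partial>lborel) = (\<integral>\<^sup>+x. (\<integral>\<^sup>+s. u x s \<partial>lborel) \<partial>P)"
proof -
  interpret product_sigma_finite "\<lambda>_::'i. lborel :: real measure" ..
  interpret P: sigma_finite_measure P
    unfolding P_def by (rule sigma_finite) fact
  interpret pair_sigma_finite P "lborel :: real measure" ..
  note measurable_rearrangement[OF u, measurable]
  have [measurable]: "(\<lambda>a. \<integral>\<^sup>+x. rearrangement (u x) a \<partial>P) \<in> borel_measurable borel"
  proof -
    have [measurable]: "(\<lambda>(a, x). rearrangement (u x) a) \<in> borel_measurable (borel \<Otimes>\<^sub>M P)"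
      using measurable_pair_swap[OF measurable_rearrangement[OF u]] by simp
    show ?thesis by measurable
  qed
  show "section_profile P L u \<in> borel_measurable borel"
    unfolding section_profile_def by measurable
  have "(\<integral>\<^sup>+a. section_profile P L u a \<partial>lborel) =
    (\<integral>\<^sup>+a. (\<integral>\<^sup>+x. indicator {0<..} a * rearrangement (u x) a \<partial>P) \<partial>lborel)"
    using AE_lborel_singleton[of "0::real"]
    by (intro nn_integral_cong_AE, eventually_elim) (auto simp: section_profile_def indicator_def)
  also have "\<dots> = (\<integral>\<^sup>+x. (\<integral>\<^sup>+a. indicator {0<..} a * rearrangement (u x) a \<partial>lborel) \<partial>P)"
    by (rule Fubini') measurable
  also have "\<dots> = (\<integral>\<^sup>+x. (\<integral>\<^sup>+s. u x s \<partial>lborel) \<partial>P)"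
    using section_measurable_PiM[OF u[unfolded P_def]]
    by (intro nn_integral_cong nn_integral_rearrangement) (auto simp: P_def space_PiM PiE_def)
  finally show "(\<integral>\<^sup>+a. section_profile P L u a \<partial>lborel) = (\<integral>\<^sup>+x. (\<integral>\<^sup>+s. u x s \<partial>lborel) \<partial>P)" .
qed

lemma SUP_section_profile:
  assumes "\<And>x s. x \<in> extensional I \<Longrightarrow> u x s \<le> f x s"
    and "L = (\<integral>\<^sup>+x. (SUP s. f x s) \<partial>(\<Pi>\<^sub>M i\<in>I. lborel))"
  shows "(SUP a. section_profile (\<Pi>\<^sub>M i\<in>I. lborel) L u a) = L"
proof (rule antisym[OF SUP_least])
  have "rearrangement (u x) a \<le> (SUP s. f x s)" if "x \<in> extensional I" "0 < a" for x a
    using rearrangement_le_SUP[OF that(2), of "u x"] SUP_mono'[OF assms(1)[OF that(1)]] by (rule order_trans)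
  then show "section_profile (\<Pi>\<^sub>M i\<in>I. lborel) L u a \<le> L" for a
    by (auto simp: section_profile_def assms(2) space_PiM PiE_def intro!: nn_integral_mono)
  have "L = section_profile (\<Pi>\<^sub>M i\<in>I. lborel) L u 0" by (simp add: section_profile_def)
  then show "L \<le> (SUP a. section_profile (\<Pi>\<^sub>M i\<in>I. lborel) L u a)" by (metis SUP_upper UNIV_I)
qed

lemma section_profile_fills:
  assumes u: "case_prod u \<in> borel_measurable ((\<Pi>\<^sub>M i\<in>I. lborel) \<Otimes>\<^sub>M borel)"
    and le: "\<And>x s. x \<in> extensional I \<Longrightarrow> u x s \<le> f x s"
    and L: "L = (\<integral>\<^sup>+x. (SUP s. f x s) \<partial>(\<Pi>\<^sub>M i\<in>I. lborel))"
    and "0 \<le> a" and r: "r < section_profile (\<Pi>\<^sub>M i\<in>I. lborel) L u a"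
  obtains \<phi> where "\<phi> \<in> borel_measurable (\<Pi>\<^sub>M i\<in>I. lborel)" "fills I f \<phi> a"
    "r < (\<integral>\<^sup>+x. \<phi> x \<partial>(\<Pi>\<^sub>M i\<in>I. lborel))"
proof (cases "a = 0")
  case True
  with r have "r < (\<integral>\<^sup>+x. (SUP s. f x s) \<partial>(\<Pi>\<^sub>M i\<in>I. lborel))"
    by (simp add: section_profile_def L)
  \<comment> \<open>By definition the integral is a supremum over simple minorants, also for a
    non-measurable projection; such a minorant is measurable and still fills at 0.\<close>
  then obtain \<phi> where \<phi>: "simple_function (\<Pi>\<^sub>M i\<in>I. lborel) \<phi>" "\<phi> \<le> (\<lambda>x. SUP s. f x s)"
      "r < integral\<^sup>S (\<Pi>\<^sub>M i\<in>I. lborel) \<phi>"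
    by (auto simp: nn_integral_def less_SUP_iff)
  show ?thesis
  proof (rule that[of \<phi>])
    show "\<phi> \<in> borel_measurable (\<Pi>\<^sub>M i\<in>I. lborel)" using \<phi>(1) by (rule borel_measurable_simple_function)
    show "fills I f \<phi> a" unfolding True by (rule fills_projection) (use \<phi>(2) in \<open>auto simp: le_fun_def\<close>)
    show "r < (\<integral>\<^sup>+x. \<phi> x \<partial>(\<Pi>\<^sub>M i\<in>I. lborel))" using \<phi>(1,3) by (simp add: nn_integral_eq_simple_integral)
  qed
next
  case False
  with \<open>0 \<le> a\<close> have "0 < a" by simp
  show ?thesis
    using r measurable_rearrangement_at[OF u] \<open>0 < a\<close> by (intro that[of "\<lambda>x. rearrangement (u x) a"] fills_rearrangement[OF u le])
      (auto simp: section_profile_def)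
qed

text \<open>\<open>f0\<close> and \<open>g0\<close> carry measurability and the integrals, f and g
  the projections and the pointwise hypothesis: the projection of a Borel minorant may be strictly
  smaller than that of f.\<close>

proposition linear_inequality_product:
  fixes f g f0 g0 h :: "('i \<Rightarrow> real) \<Rightarrow> real \<Rightarrow> ennreal" and p l :: real and I :: "'i set"
  defines "P \<equiv> (\<Pi>\<^sub>M i\<in>I. (lborel :: real measure))"
  assumes I: "finite I"
    and f0: "case_prod f0 \<in> borel_measurable (P \<Otimes>\<^sub>M borel)" "\<And>x s. x \<in> extensional I \<Longrightarrow> f0 x s \<le> f x s"
    and g0: "case_prod g0 \<in> borel_measurable (P \<Otimes>\<^sub>M borel)" "\<And>x s. x \<in> extensional I \<Longrightarrow> g0 x s \<le> g x s"
    and h_meas: "case_prod h \<in> borel_measurable (P \<Otimes>\<^sub>M borel)"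
    and p: "p < 0" "real (card I) < - 1 / p" and l: "0 < l" "l < 1"
    and h: "\<And>x y s t. x \<in> extensional I \<Longrightarrow> y \<in> extensional I \<Longrightarrow>
      p_mean p (f x s) (g y t) l \<le> h (\<lambda>i\<in>I. (1 - l) * x i + l * y i) ((1 - l) * s + l * t)"
    and proj: "(\<integral>\<^sup>+x. (SUP s. f x s) \<partial>P) = (\<integral>\<^sup>+x. (SUP s. g x s) \<partial>P)"
  shows "ennreal (1 - l) * (\<integral>\<^sup>+x. (\<integral>\<^sup>+s. f0 x s \<partial>lborel) \<partial>P) + ennreal l * (\<integral>\<^sup>+x. (\<integral>\<^sup>+s. g0 x s \<partial>lborel) \<partial>P)
    \<le> (\<integral>\<^sup>+x. (\<integral>\<^sup>+s. h x s \<partial>lborel) \<partial>P)"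
proof -
  define L where "L = (\<integral>\<^sup>+x. (SUP s. f x s) \<partial>P)"
  have L': "L = (\<integral>\<^sup>+x. (SUP s. g x s) \<partial>P)" using proj by (simp add: L_def)
  \<comment> \<open>The value \<infinity> at 0 settles the case a = b = 0, in which
    \<open>fills\<close> gives no information about h; the integral of \<open>?X\<close> does not
    see it.\<close>
  let ?F = "section_profile P L f0" and ?G = "section_profile P L g0" and ?X = "section_profile P \<infinity> h"
  note f0' = f0[unfolded P_def] and g0' = g0[unfolded P_def] and h_meas' = h_meas[unfolded P_def]
  have "ennreal (1 - l) * (\<integral>\<^sup>+a. ?F a \<partial>lborel) + ennreal l * (\<integral>\<^sup>+a. ?G a \<partial>lborel) \<le> (\<integral>\<^sup>+a. ?X a \<partial>lborel)"
  proof (rule one_dim_min_inequality[OF _ _ _ l])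
    show "?F \<in> borel_measurable borel" "?G \<in> borel_measurable borel" "?X \<in> borel_measurable borel"
      unfolding P_def by (intro measurable_section_profile I f0' g0' h_meas')+
    show "(SUP a. ?F a) = (SUP a. ?G a)"
      unfolding P_def
      by (simp only: SUP_section_profile[OF f0'(2) L_def[unfolded P_def]] SUP_section_profile[OF g0'(2) L'[unfolded P_def]])
    fix a b
    show "min (?F a) (?G b) \<le> ?X ((1 - l) * a + l * b)"
    proof (cases "0 \<le> a \<and> 0 \<le> b")
      case False
      then show ?thesis by (auto simp: section_profile_def)
    next
      case True
      show ?thesis
      proof (cases "(1 - l) * a + l * b = 0")
        case True
        then show ?thesis by (simp add: section_profile_def)
      next
        case c: False
        have "0 \<le> (1 - l) * a + l * b" using True l by simp
        with c have c: "0 < (1 - l) * a + l * b" by linarith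
        show ?thesis
        \<comment> \<open>Below each profile value there is a measurable function that fills, so it
          is enough to treat r strictly below both values.\<close>
        proof (rule dense_le)
          fix r assume r: "r < min (?F a) (?G b)"
          obtain \<phi> where \<phi>: "\<phi> \<in> borel_measurable P" "fills I f \<phi> a" "r < (\<integral>\<^sup>+x. \<phi> x \<partial>P)"
            using r True section_profile_fills[OF f0' L_def[unfolded P_def], of a r] unfolding P_def by auto
          obtain \<psi> where \<psi>: "\<psi> \<in> borel_measurable P" "fills I g \<psi> b" "r < (\<integral>\<^sup>+x. \<psi> x \<partial>P)"
            using r True section_profile_fills[OF g0' L'[unfolded P_def], of b r] unfolding P_def by auto
          have "r \<le> min (\<integral>\<^sup>+x. \<phi> x \<partial>P) (\<integral>\<^sup>+x. \<psi> x \<partial>P)" using \<phi>(3) \<psi>(3) by (simp add: less_imp_le)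
          also have "\<dots> \<le> (\<integral>\<^sup>+x. rearrangement (h x) ((1 - l) * a + l * b) \<partial>P)"
            using True unfolding P_def
            by (intro fills_inequality[OF I h_meas' \<phi>(1)[unfolded P_def] \<psi>(1)[unfolded P_def] p l h \<phi>(2) \<psi>(2)]) auto
          also have "\<dots> = ?X ((1 - l) * a + l * b)" using c by (simp add: section_profile_def)
          finally show "r \<le> ?X ((1 - l) * a + l * b)" .
        qed
      qed
    qed
  qed
  then show ?thesis
    unfolding P_def
    by (simp only: nn_integral_section_profile[OF I f0'(1)] nn_integral_section_profile[OF I g0'(1)]
        nn_integral_section_profile[OF I h_meas'])
qed

section \<open>Orthonormal coordinates\<close>

text \<open>A Borel version of f is set to 0 on a null set that contains all disagreements. The
  bound has to hold everywhere, since the sup-convolution sees single points.\<close>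

lemma completion_borel_minorant:
  fixes f :: "'a \<Rightarrow> ennreal"
  assumes "f \<in> borel_measurable (completion M)"
  obtains f0 where "f0 \<in> borel_measurable M" "\<And>x. f0 x \<le> f x"
    "(\<integral>\<^sup>+x. f x \<partial>completion M) = (\<integral>\<^sup>+x. f0 x \<partial>M)"
proof -
  obtain f' where [measurable]: "f' \<in> borel_measurable M" and ae: "AE x in M. f x = f' x"
    using completion_ex_borel_measurable[OF assms] by blast
  obtain N where N: "{x \<in> space M. \<not> f x = f' x} \<subseteq> N" "emeasure M N = 0" and [measurable]: "N \<in> sets M"
    using AE_E[OF ae] by blast
  define f0 where "f0 x = f' x * indicator (space M - N) x" for x
  have "f0 \<in> borel_measurable M" unfolding f0_def by measurable
  moreover have "f0 x \<le> f x" for x using N(1) by (auto simp: f0_def indicator_def)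
  moreover have "AE x in M. x \<notin> N" using N(2) by (intro AE_not_in) auto
  with ae AE_space have "AE x in M. f x = f0 x" by eventually_elim (auto simp: f0_def)
  then have "(\<integral>\<^sup>+x. f x \<partial>completion M) = (\<integral>\<^sup>+x. f0 x \<partial>M)"
    unfolding nn_integral_completion by (rule nn_integral_cong_AE)
  ultimately show ?thesis by (rule that)
qed

lemma completion_borel_majorant:
  fixes f :: "'a \<Rightarrow> ennreal"
  assumes "f \<in> borel_measurable (completion M)"
  obtains f1 where "f1 \<in> borel_measurable M" "\<And>x. x \<in> space M \<Longrightarrow> f x \<le> f1 x"
    "(\<integral>\<^sup>+x. f x \<partial>completion M) = (\<integral>\<^sup>+x. f1 x \<partial>M)"
proof -
  obtain f' where [measurable]: "f' \<in> borel_measurable M" and ae: "AE x in M. f x = f' x"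
    using completion_ex_borel_measurable[OF assms] by blast
  obtain N where N: "{x \<in> space M. \<not> f x = f' x} \<subseteq> N" "emeasure M N = 0" and [measurable]: "N \<in> sets M"
    using AE_E[OF ae] by blast
  define f1 where "f1 x = (if x \<in> N then \<infinity> else f' x)" for x
  have "f1 \<in> borel_measurable M" unfolding f1_def by measurable
  moreover have "f x \<le> f1 x" if "x \<in> space M" for x using N(1) that by (auto simp: f1_def)
  moreover have "AE x in M. x \<notin> N" using N(2) by (intro AE_not_in) auto
  with ae have "AE x in M. f x = f1 x" by eventually_elim (auto simp: f1_def)
  then have "(\<integral>\<^sup>+x. f x \<partial>completion M) = (\<integral>\<^sup>+x. f1 x \<partial>M)"
    unfolding nn_integral_completion by (rule nn_integral_cong_AE)
  ultimately show ?thesis by (rule that)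
qed

section \<open>Lebesgue measure in orthonormal coordinates\<close>

text \<open>A bijection measurable in both directions carries simple minorants to measurable
  minorants either way, so u may be arbitrary. This is what allows the integral of a projection over
  H to be written in coordinates.\<close>

lemma nn_integral_distr_bij:
  fixes u :: "'b \<Rightarrow> ennreal"
  assumes T: "T \<in> M \<rightarrow>\<^sub>M N" and T': "T' \<in> N \<rightarrow>\<^sub>M M"
    and inv: "\<And>x. x \<in> space M \<Longrightarrow> T' (T x) = x" "\<And>y. y \<in> space N \<Longrightarrow> T (T' y) = y"
  shows "(\<integral>\<^sup>+y. u y \<partial>distr M N T) = (\<integral>\<^sup>+x. u (T x) \<partial>M)"
proof (rule antisym)
  show "(\<integral>\<^sup>+y. u y \<partial>distr M N T) \<le> (\<integral>\<^sup>+x. u (T x) \<partial>M)"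
    unfolding nn_integral_def[of "distr M N T"]
  proof (rule SUP_least, clarify)
    fix s assume s: "simple_function (distr M N T) s" "s \<le> u"
    then have [measurable]: "s \<in> borel_measurable N"
      using borel_measurable_simple_function[OF s(1)] by simp
    have "integral\<^sup>S (distr M N T) s = (\<integral>\<^sup>+y. s y \<partial>distr M N T)"
      using s(1) by (rule nn_integral_eq_simple_integral[symmetric])
    also have "\<dots> = (\<integral>\<^sup>+x. s (T x) \<partial>M)" using T by (intro nn_integral_distr) auto
    also have "\<dots> \<le> (\<integral>\<^sup>+x. u (T x) \<partial>M)" using s(2) by (intro nn_integral_mono) (auto simp: le_fun_def)
    finally show "integral\<^sup>S (distr M N T) s \<le> (\<integral>\<^sup>+x. u (T x) \<partial>M)" .
  qed
  show "(\<integral>\<^sup>+x. u (T x) \<partial>M) \<le> (\<integral>\<^sup>+y. u y \<partial>distr M N T)"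
    unfolding nn_integral_def[of M]
  proof (rule SUP_least, clarify)
    fix s assume s: "simple_function M s" "s \<le> (\<lambda>x. u (T x))"
    have "(\<lambda>y. s (T' y)) \<in> borel_measurable N"
      using T' borel_measurable_simple_function[OF s(1)] by (rule measurable_compose)
    then have "(\<integral>\<^sup>+y. s (T' y) \<partial>distr M N T) = (\<integral>\<^sup>+x. s (T' (T x)) \<partial>M)" using T by (intro nn_integral_distr) simp_all
    also have "\<dots> = (\<integral>\<^sup>+x. s x \<partial>M)" by (intro nn_integral_cong) (simp add: inv)
    also have "\<dots> = integral\<^sup>S M s" using s(1) by (rule nn_integral_eq_simple_integral)
    finally have "integral\<^sup>S M s = (\<integral>\<^sup>+y. s (T' y) \<partial>distr M N T)" ..
    also have "\<dots> \<le> (\<integral>\<^sup>+y. u y \<partial>distr M N T)"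
    proof (rule nn_integral_mono)
      fix y assume "y \<in> space (distr M N T)"
      then show "s (T' y) \<le> u y" using s(2)[unfolded le_fun_def, rule_format, of "T' y"] inv(2)[of y] by simp
    qed
    finally show "integral\<^sup>S M s \<le> (\<integral>\<^sup>+y. u y \<partial>distr M N T)" .
  qed
qed

lemma inner_sum_orthonormal:
  fixes B :: "'a::euclidean_space set"
  assumes "finite B" "pairwise orthogonal B" "\<And>b. b \<in> B \<Longrightarrow> norm b = 1" "a \<in> B"
  shows "(\<Sum>b\<in>B. c b *\<^sub>R b) \<bullet> a = c a"
proof -
  have "(\<Sum>b\<in>B. c b *\<^sub>R b) \<bullet> a = (\<Sum>b\<in>B. if b = a then c a else 0)"
    unfolding inner_sum_left using assms
    by (intro sum.cong) (auto simp: pairwise_def orthogonal_def norm_eq_1)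
  then show ?thesis using assms by simp
qed

lemma sum_inner_orthonormal:
  fixes B :: "'a::euclidean_space set"
  assumes fin: "finite B" and orth: "pairwise orthogonal B" and norm: "\<And>b. b \<in> B \<Longrightarrow> norm b = 1"
    and x: "x \<in> span B"
  shows "(\<Sum>b\<in>B. (x \<bullet> b) *\<^sub>R b) = x"
proof -
  obtain c where c: "x = (\<Sum>b\<in>B. c b *\<^sub>R b)" using x span_finite[OF fin] by auto
  show ?thesis unfolding c
    by (intro sum.cong refl) (simp add: inner_sum_orthonormal[OF fin orth norm])
qed

lemma nn_integral_lebesgue_sub:
  fixes V :: "'a::euclidean_space set" and u :: "'a \<Rightarrow> ennreal"
  defines "B \<equiv> orthonormal_basis V"
  assumes B: "B \<subseteq> V" "finite B" "pairwise orthogonal B" "\<And>b. b \<in> B \<Longrightarrow> norm b = 1" "span B = V"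
  shows "(\<integral>\<^sup>+x. u x \<partial>lebesgue_sub V) = (\<integral>\<^sup>+c. u (\<Sum>b\<in>B. c b *\<^sub>R b) \<partial>(\<Pi>\<^sub>M b\<in>B. lborel))"
  unfolding lebesgue_sub_def nn_integral_completion B_def[symmetric]
proof (rule nn_integral_distr_bij)
  have "(\<lambda>c. \<Sum>b\<in>B. c b *\<^sub>R b) \<in> borel_measurable (\<Pi>\<^sub>M b\<in>B. (lborel :: real measure))"
    by measurable
  moreover have "(\<Sum>b\<in>B. c b *\<^sub>R b) \<in> V" for c
    unfolding B(5)[symmetric] by (intro span_sum span_scale span_base)
  ultimately show "(\<lambda>c. \<Sum>b\<in>B. c b *\<^sub>R b) \<in> (\<Pi>\<^sub>M b\<in>B. (lborel :: real measure)) \<rightarrow>\<^sub>M restrict_space borel V"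
    by (intro measurable_restrict_space2) auto
  have [measurable]: "(\<lambda>x. x \<bullet> b) \<in> restrict_space borel V \<rightarrow>\<^sub>M lborel" for b :: 'a
    by (rule measurable_restrict_space1) simp
  show "(\<lambda>x. \<lambda>b\<in>B. x \<bullet> b) \<in> restrict_space borel V \<rightarrow>\<^sub>M (\<Pi>\<^sub>M b\<in>B. (lborel :: real measure))"
    by measurable
  show "(\<lambda>b\<in>B. (\<Sum>b\<in>B. c b *\<^sub>R b) \<bullet> b) = c" if "c \<in> space (\<Pi>\<^sub>M b\<in>B. (lborel :: real measure))" for c
    using that by (auto simp: fun_eq_iff inner_sum_orthonormal[OF B(2-4)] space_PiM PiE_def extensional_def)
  show "(\<Sum>b\<in>B. (\<lambda>b\<in>B. x \<bullet> b) b *\<^sub>R b) = x" if "x \<in> space (restrict_space borel V)" for x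
    using that sum_inner_orthonormal[OF B(2-4), of x] B(5) by (simp add: space_restrict_space)
qed

lemma nn_integral_lborel_translate:
  fixes f :: "'a::euclidean_space \<Rightarrow> ennreal"
  assumes [measurable]: "f \<in> borel_measurable borel"
  shows "(\<integral>\<^sup>+x. f (c + x) \<partial>lborel) = (\<integral>\<^sup>+x. f x \<partial>lborel)"
proof -
  have "(\<integral>\<^sup>+x. f x \<partial>lborel) = (\<integral>\<^sup>+x. f x \<partial>distr lborel borel ((+) c))"
    by (simp add: lborel_distr_plus)
  then show ?thesis by (simp add: nn_integral_distr)
qed

text \<open>Both the image of Lebesgue measure under \<open>R\<close> and Lebesgue measure itself are translation
  invariant; evaluating \<open>\<integral>\<integral> 1\<^sub>U(R x) f(R x + y)\<close> with the unit ball \<open>U\<close> in both orders shows that they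
  agree.\<close>

lemma nn_integral_lborel_isometry:
  fixes R :: "'a::euclidean_space \<Rightarrow> 'a" and f :: "'a \<Rightarrow> ennreal"
  assumes "linear R" and norm: "\<And>x. norm (R x) = norm x" and [measurable]: "f \<in> borel_measurable borel"
  shows "(\<integral>\<^sup>+x. f (R x) \<partial>lborel) = (\<integral>\<^sup>+x. f x \<partial>lborel)"
proof -
  have [measurable]: "R \<in> borel_measurable borel"
    using linear_continuous_on[of R UNIV] \<open>linear R\<close>
    by (intro borel_measurable_continuous_onI) (simp add: linear_conv_bounded_linear)
  have "inj R"
    unfolding linear_injective_0[OF \<open>linear R\<close>] by (metis norm norm_eq_zero)
  then have "surj R" by (rule linear_injective_imp_surjective[OF \<open>linear R\<close>]) simp
  let ?U = "ball (0::'a) 1"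
  have [measurable]: "?U \<in> sets borel" by simp
  define m where "m = emeasure lborel ?U"
  have ball: "emeasure lborel (ball z 1) = m" for z :: 'a
    using emeasure_ball[of 1 z] emeasure_ball[of 1 "0::'a"] unfolding m_def by simp
  have "m \<noteq> 0"
    using content_ball_pos[of 1 "0::'a"] by (auto simp: m_def measure_def)
  have "m \<noteq> top" using emeasure_lborel_ball_finite[of "0::'a" 1] by (simp add: m_def less_top)
  have "(\<integral>\<^sup>+x. (\<integral>\<^sup>+y. indicator ?U (R x) * f (R x + y) \<partial>lborel) \<partial>lborel) = m * (\<integral>\<^sup>+x. f x \<partial>lborel)"
  proof -
    have "(\<integral>\<^sup>+y. indicator ?U (R x) * f (R x + y) \<partial>lborel) = indicator ?U x * (\<integral>\<^sup>+x. f x \<partial>lborel)" for x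
      using nn_integral_lborel_translate[of f "R x"] by (simp add: nn_integral_cmult indicator_def norm)
    then have "(\<integral>\<^sup>+x. (\<integral>\<^sup>+y. indicator ?U (R x) * f (R x + y) \<partial>lborel) \<partial>lborel) =
      (\<integral>\<^sup>+x. (\<integral>\<^sup>+x. f x \<partial>lborel) * indicator ?U x \<partial>lborel)"
      by (simp add: mult.commute)
    also have "\<dots> = (\<integral>\<^sup>+x. f x \<partial>lborel) * m"
      unfolding m_def by (rule nn_integral_cmult_indicator) simp
    finally show ?thesis by (simp add: mult.commute)
  qed
  moreover have "(\<integral>\<^sup>+x. (\<integral>\<^sup>+y. indicator ?U (R x) * f (R x + y) \<partial>lborel) \<partial>lborel) = m * (\<integral>\<^sup>+x. f (R x) \<partial>lborel)"
  proof -
    have "(\<integral>\<^sup>+x. (\<integral>\<^sup>+y. indicator ?U (R x) * f (R x + y) \<partial>lborel) \<partial>lborel) =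
      (\<integral>\<^sup>+y. (\<integral>\<^sup>+x. indicator ?U (R x) * f (R x + y) \<partial>lborel) \<partial>lborel)"
      by (rule lborel_pair.Fubini'[symmetric]) measurable
    also have "\<dots> = (\<integral>\<^sup>+y. (\<integral>\<^sup>+x. indicator ?U (R x - y) * f (R x) \<partial>lborel) \<partial>lborel)"
    proof (rule nn_integral_cong)
      fix y :: 'a
      \<comment> \<open>Since y is the image of w, shifting x by w moves y out of the argument of f
        and into that of the indicator.\<close>
      obtain w where "y = R w" using \<open>surj R\<close> by (metis surjD)
      then have "indicator ?U (R x) * f (R x + y) = indicator ?U (R (w + x) - y) * f (R (w + x))" for x
        by (simp add: linear_add[OF \<open>linear R\<close>] add.commute)
      then have "(\<integral>\<^sup>+x. indicator ?U (R x) * f (R x + y) \<partial>lborel) =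
        (\<integral>\<^sup>+x. indicator ?U (R (w + x) - y) * f (R (w + x)) \<partial>lborel)"
        by (intro nn_integral_cong)
      also have "\<dots> = (\<integral>\<^sup>+x. indicator ?U (R x - y) * f (R x) \<partial>lborel)"
        by (rule nn_integral_lborel_translate) measurable
      finally show "(\<integral>\<^sup>+x. indicator ?U (R x) * f (R x + y) \<partial>lborel) =
        (\<integral>\<^sup>+x. indicator ?U (R x - y) * f (R x) \<partial>lborel)" .
    qed
    also have "\<dots> = (\<integral>\<^sup>+x. (\<integral>\<^sup>+y. indicator ?U (R x - y) * f (R x) \<partial>lborel) \<partial>lborel)"
      by (rule lborel_pair.Fubini') measurable
    also have "\<dots> = (\<integral>\<^sup>+x. m * f (R x) \<partial>lborel)"
    proof (rule nn_integral_cong)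
      fix x
      have "(\<integral>\<^sup>+y. indicator ?U (R x - y) * f (R x) \<partial>lborel) =
        (\<integral>\<^sup>+y. f (R x) * indicator (ball (R x) 1) y \<partial>lborel)"
        by (intro nn_integral_cong) (auto simp: indicator_def dist_norm norm_minus_commute)
      also have "\<dots> = f (R x) * m"
        unfolding ball[of "R x", symmetric] by (rule nn_integral_cmult_indicator) simp
      finally show "(\<integral>\<^sup>+y. indicator ?U (R x - y) * f (R x) \<partial>lborel) = m * f (R x)"
        by (simp add: mult.commute)
    qed
    finally show ?thesis by (simp add: nn_integral_cmult)
  qed
  ultimately show ?thesis
    using \<open>m \<noteq> 0\<close> \<open>m \<noteq> top\<close> by (simp add: ennreal_mult_cancel_left)
qed

lemma PiM_reindex_lborel:
  fixes B :: "'i set" and C :: "'j set"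
  assumes "finite B" and \<rho>: "bij_betw \<rho> B C"
  shows "distr (\<Pi>\<^sub>M i\<in>C. (lborel :: real measure)) (\<Pi>\<^sub>M b\<in>B. lborel) (\<lambda>c. \<lambda>b\<in>B. c (\<rho> b)) = (\<Pi>\<^sub>M b\<in>B. lborel)"
proof -
  interpret B: product_sigma_finite "\<lambda>_::'i. lborel :: real measure" ..
  interpret C: product_sigma_finite "\<lambda>_::'j. lborel :: real measure" ..
  have "finite C" using assms bij_betw_finite by blast
  have \<rho>_in: "\<rho> b \<in> C" if "b \<in> B" for b using \<rho> that by (auto simp: bij_betw_def)
  have meas: "(\<lambda>c. \<lambda>b\<in>B. c (\<rho> b)) \<in> (\<Pi>\<^sub>M i\<in>C. (lborel :: real measure)) \<rightarrow>\<^sub>M (\<Pi>\<^sub>M b\<in>B. lborel)"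
    using \<rho>_in by (intro measurable_restrict measurable_component_singleton)
  show ?thesis
  proof (rule B.PiM_eqI[OF \<open>finite B\<close>])
    fix A :: "_ \<Rightarrow> real set" assume A: "\<And>b. b \<in> B \<Longrightarrow> A b \<in> sets lborel"
    define A' where "A' = A \<circ> inv_into B \<rho>"
    have A': "A' (\<rho> b) = A b" if "b \<in> B" for b
      using \<rho> that by (simp add: A'_def bij_betw_def)
    have "(\<lambda>c. \<lambda>b\<in>B. c (\<rho> b)) -` Pi\<^sub>E B A \<inter> space (\<Pi>\<^sub>M i\<in>C. (lborel :: real measure)) = Pi\<^sub>E C A'"
      using \<rho> by (auto simp: space_PiM PiE_iff bij_betw_def A')
    then have "emeasure (distr (\<Pi>\<^sub>M i\<in>C. (lborel :: real measure)) (\<Pi>\<^sub>M b\<in>B. lborel) (\<lambda>c. \<lambda>b\<in>B. c (\<rho> b))) (Pi\<^sub>E B A)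
      = emeasure (\<Pi>\<^sub>M i\<in>C. (lborel :: real measure)) (Pi\<^sub>E C A')"
      using A \<open>finite B\<close> by (subst emeasure_distr[OF meas]) (auto intro: sets_PiM_I_finite)
    also have "\<dots> = (\<Prod>i\<in>C. emeasure lborel (A' i))"
    proof (rule C.emeasure_PiM[OF \<open>finite C\<close>])
      fix i assume "i \<in> C"
      then obtain b where "b \<in> B" "i = \<rho> b" using \<rho> by (auto simp: bij_betw_def)
      then show "A' i \<in> sets lborel" using A A' by simp
    qed
    also have "\<dots> = (\<Prod>b\<in>B. emeasure lborel (A' (\<rho> b)))"
      using prod.reindex_bij_betw[OF \<rho>, of "\<lambda>i. emeasure lborel (A' i)"] by simp
    also have "\<dots> = (\<Prod>b\<in>B. emeasure lborel (A b))" by (intro prod.cong) (auto simp: A')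
    finally show "emeasure (distr (\<Pi>\<^sub>M i\<in>C. (lborel :: real measure)) (\<Pi>\<^sub>M b\<in>B. lborel) (\<lambda>c. \<lambda>b\<in>B. c (\<rho> b))) (Pi\<^sub>E B A)
      = (\<Prod>b\<in>B. emeasure lborel (A b))" .
  qed simp
qed

text \<open>In standard coordinates \<open>lborel\<close> is a product measure by definition. The
  isometry R sends the standard basis vector \<rho> b to b, so isometry invariance transfers this to
  the basis B.\<close>

lemma nn_integral_lborel_orthonormal:
  fixes B :: "'a::euclidean_space set" and f :: "'a \<Rightarrow> ennreal"
  assumes B: "finite B" "card B = DIM('a)" "pairwise orthogonal B" "\<And>b. b \<in> B \<Longrightarrow> norm b = 1"
    and [measurable]: "f \<in> borel_measurable borel"
  shows "(\<integral>\<^sup>+x. f x \<partial>lborel) = (\<integral>\<^sup>+c. f (\<Sum>b\<in>B. c b *\<^sub>R b) \<partial>(\<Pi>\<^sub>M b\<in>B. lborel))"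
proof -
  obtain \<rho> where \<rho>: "bij_betw \<rho> B (Basis :: 'a set)"
    using finite_same_card_bij[OF B(1) finite_Basis] B(2) by auto
  define R where "R x = (\<Sum>b\<in>B. (x \<bullet> \<rho> b) *\<^sub>R b)" for x :: 'a
  have "linear R"
    unfolding R_def by (intro linear_compose_sum ballI linear_scaleR_left linear_compose[unfolded comp_def, OF _ linear_scaleR_left])
      (auto intro!: linearI simp: inner_add_left scaleR_add_left)
  have inner_R: "R x \<bullet> b = x \<bullet> \<rho> b" if "b \<in> B" for x b
    unfolding R_def using inner_sum_orthonormal[OF B(1,3,4) that, of "\<lambda>b. x \<bullet> \<rho> b"] by simp
  have "R x \<bullet> R x = x \<bullet> x" for x
  proof -
    have "R x \<bullet> R x = (\<Sum>b\<in>B. (x \<bullet> \<rho> b) * (R x \<bullet> b))"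
      by (subst (2) R_def) (simp add: inner_sum_right)
    also have "\<dots> = (\<Sum>b\<in>B. (x \<bullet> \<rho> b) * (x \<bullet> \<rho> b))" by (simp add: inner_R)
    also have "\<dots> = (\<Sum>i\<in>Basis. (x \<bullet> i) * (x \<bullet> i))"
      by (rule sum.reindex_bij_betw[OF \<rho>])
    finally show ?thesis by (simp add: euclidean_inner[of x x])
  qed
  then have norm: "norm (R x) = norm x" for x by (simp add: norm_eq_sqrt_inner)
  have [measurable]: "R \<in> borel_measurable borel" unfolding R_def by measurable
  have \<rho>_in: "\<rho> b \<in> Basis" if "b \<in> B" for b using \<rho> that by (auto simp: bij_betw_def)
  have meas: "(\<lambda>c. \<lambda>b\<in>B. c (\<rho> b)) \<in> (\<Pi>\<^sub>M i\<in>Basis. (lborel :: real measure)) \<rightarrow>\<^sub>M (\<Pi>\<^sub>M b\<in>B. lborel)"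
    using \<rho>_in by (intro measurable_restrict measurable_component_singleton)
  have [measurable]: "(\<lambda>c. \<Sum>b\<in>B. c b *\<^sub>R b) \<in> borel_measurable (\<Pi>\<^sub>M b\<in>B. (lborel :: real measure))"
    by measurable
  have "(\<integral>\<^sup>+x. f x \<partial>lborel) = (\<integral>\<^sup>+x. f (R x) \<partial>(lborel :: 'a measure))"
    by (rule nn_integral_lborel_isometry[symmetric, OF \<open>linear R\<close> norm]) measurable
  also have "\<dots> = (\<integral>\<^sup>+c. f (R (\<Sum>i\<in>Basis. c i *\<^sub>R i)) \<partial>(\<Pi>\<^sub>M i\<in>Basis. lborel))"
    by (subst lborel_eq) (simp add: nn_integral_distr)
  also have "\<dots> = (\<integral>\<^sup>+c. f (\<Sum>b\<in>B. (\<lambda>b\<in>B. c (\<rho> b)) b *\<^sub>R b) \<partial>(\<Pi>\<^sub>M i\<in>Basis. lborel))"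
    unfolding R_def using \<rho>_in
    by (intro nn_integral_cong arg_cong[where f = f] sum.cong) (auto simp: inner_sum_left inner_Basis if_distrib cong: if_cong)
  also have "\<dots> = (\<integral>\<^sup>+c. f (\<Sum>b\<in>B. c b *\<^sub>R b)
      \<partial>distr (\<Pi>\<^sub>M i\<in>Basis. (lborel :: real measure)) (\<Pi>\<^sub>M b\<in>B. lborel) (\<lambda>c. \<lambda>b\<in>B. c (\<rho> b)))"
    by (rule nn_integral_distr[OF meas, symmetric]) measurable
  also have "\<dots> = (\<integral>\<^sup>+c. f (\<Sum>b\<in>B. c b *\<^sub>R b) \<partial>(\<Pi>\<^sub>M b\<in>B. lborel))"
    by (simp only: PiM_reindex_lborel[OF B(1) \<rho>])
  finally show ?thesis .
qed

lemma unit_normal_linear_hyperplane: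
  fixes H :: "'a::euclidean_space set"
  assumes "H \<in> linear_hyperplanes"
  shows "norm (unit_normal H) = 1" "unit_normal H \<in> orthogonal_comp H"
proof -
  \<comment> \<open>The truncated subtraction in \<open>linear_hyperplanes\<close> still gives a
    strict inequality because the dimension is positive.\<close>
  from assms have H: "subspace H" "dim H < DIM('a)"
    using DIM_positive[where 'a = 'a] unfolding linear_hyperplanes_def by auto
  obtain x where x: "x \<noteq> 0" "\<And>y. y \<in> span H \<Longrightarrow> orthogonal x y"
    using orthogonal_to_subspace_exists[OF H(2)] by blast
  have "norm (x /\<^sub>R norm x) = 1" using x(1) by simp
  moreover have "x /\<^sub>R norm x \<in> orthogonal_comp H"
    using x(2) span_base[of _ H] by (auto simp: orthogonal_comp_def orthogonal_def inner_commute)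
  ultimately have "\<exists>v. norm v = 1 \<and> v \<in> orthogonal_comp H" by blast
  then have "norm (unit_normal H) = 1 \<and> unit_normal H \<in> orthogonal_comp H"
    unfolding unit_normal_def by (rule someI_ex)
  then show "norm (unit_normal H) = 1" "unit_normal H \<in> orthogonal_comp H" by auto
qed

lemma orthonormal_basis:
  fixes V :: "'a::euclidean_space set"
  assumes "subspace V"
  shows "orthonormal_basis V \<subseteq> V" "pairwise orthogonal (orthonormal_basis V)"
    "\<And>b. b \<in> orthonormal_basis V \<Longrightarrow> norm b = 1" "span (orthonormal_basis V) = V"
    "finite (orthonormal_basis V)" "card (orthonormal_basis V) = dim V"
proof -
  let ?Q = "\<lambda>B. B \<subseteq> V \<and> pairwise orthogonal B \<and> (\<forall>b\<in>B. norm b = 1) \<and> independent B \<and> span B = V"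
  have "\<exists>B. ?Q B" using orthonormal_basis_subspace[OF assms] by metis
  then have "?Q (orthonormal_basis V)" unfolding orthonormal_basis_def by (rule someI_ex)
  then show "orthonormal_basis V \<subseteq> V" "pairwise orthogonal (orthonormal_basis V)"
    "\<And>b. b \<in> orthonormal_basis V \<Longrightarrow> norm b = 1" "span (orthonormal_basis V) = V"
    "finite (orthonormal_basis V)" "card (orthonormal_basis V) = dim V"
    by (auto simp: independent_imp_finite indep_card_eq_dim_span)
qed

section \<open>The inequality in coordinates adapted to H\<close>

theorem theorem4p3:
  fixes f g :: "real ^ 'n \<Rightarrow> ennreal" and p lam :: real
  assumes "- 1 / real CARD('n) \<le> p" and "p < 0"
    and "0 < lam" and "lam < 1"
    and "f \<in> borel_measurable lebesgue" and "g \<in> borel_measurable lebesgue"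
    and "sup_conv p lam f g \<in> borel_measurable lebesgue"
    and "\<exists>H \<in> linear_hyperplanes.
           sup_conv p lam (steiner_fun H f) (steiner_fun H g) \<in> borel_measurable lebesgue
         \<and> sup_conv (-\<infinity>) lam (schwarz_fun H (steiner_fun H f)) (schwarz_fun H (steiner_fun H g))
             \<in> borel_measurable lebesgue
         \<and> (\<integral>\<^sup>+x. proj_fun H f x \<partial>lebesgue_sub H) = (\<integral>\<^sup>+x. proj_fun H g x \<partial>lebesgue_sub H)"
  shows "(\<integral>\<^sup>+x. sup_conv p lam f g x \<partial>lebesgue)
         \<ge> ennreal (1 - lam) * (\<integral>\<^sup>+x. f x \<partial>lebesgue) + ennreal lam * (\<integral>\<^sup>+x. g x \<partial>lebesgue)"
proof -
  obtain H :: "(real ^ 'n) set" where H: "H \<in> linear_hyperplanes"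
    and proj: "(\<integral>\<^sup>+x. proj_fun H f x \<partial>lebesgue_sub H) = (\<integral>\<^sup>+x. proj_fun H g x \<partial>lebesgue_sub H)"
    using assms(8) by blast
  define B where "B = orthonormal_basis H"
  define v where "v = unit_normal H"
  define E where "E c = (\<Sum>b\<in>B. c b *\<^sub>R b)" for c :: "real ^ 'n \<Rightarrow> real"
  have "subspace H" and dimH: "dim H = CARD('n) - 1" using H by (auto simp: linear_hyperplanes_def)
  note B = orthonormal_basis[OF \<open>subspace H\<close>, folded B_def]
  note v = unit_normal_linear_hyperplane[OF H, folded v_def]
  have orth_v: "b \<bullet> v = 0" "v \<bullet> b = 0" if "b \<in> B" for b
    using v(2) B(1) that by (auto simp: orthogonal_comp_def orthogonal_def inner_commute)
  have "v \<notin> B" using orth_v(1)[of v] v(1) by auto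
  have card_B: "card B = CARD('n) - 1" using B(6) dimH by simp
  let ?P = "\<Pi>\<^sub>M b\<in>B. (lborel :: real measure)"
  interpret product_sigma_finite "\<lambda>_::real ^ 'n. lborel :: real measure" ..
  \<comment> \<open>Adding v as one more index to B gives an orthonormal basis of the whole space;
    splitting that index off the product is Fubini along the normal direction.\<close>
  have coord: "(\<lambda>(c, s). u (E c + s *\<^sub>R v)) \<in> borel_measurable (?P \<Otimes>\<^sub>M borel)"
    "(\<integral>\<^sup>+x. u x \<partial>lborel) = (\<integral>\<^sup>+c. (\<integral>\<^sup>+s. u (E c + s *\<^sub>R v) \<partial>lborel) \<partial>?P)"
    if [measurable]: "u \<in> borel_measurable borel" for u :: "real ^ 'n \<Rightarrow> ennreal"
  proof -
    show "(\<lambda>(c, s). u (E c + s *\<^sub>R v)) \<in> borel_measurable (?P \<Otimes>\<^sub>M borel)"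
      unfolding E_def by measurable
    have "(\<integral>\<^sup>+x. u x \<partial>lborel) = (\<integral>\<^sup>+c. u (\<Sum>b\<in>insert v B. c b *\<^sub>R b) \<partial>(\<Pi>\<^sub>M b\<in>insert v B. lborel))"
    proof (rule nn_integral_lborel_orthonormal)
      show "card (insert v B) = DIM(real ^ 'n)" using \<open>v \<notin> B\<close> B(5) card_B by simp
      show "pairwise orthogonal (insert v B)"
        using B(2) orth_v by (auto simp: pairwise_insert orthogonal_def)
    qed (use B v(1) in auto)
    also have "\<dots> = (\<integral>\<^sup>+c. (\<integral>\<^sup>+s. u (\<Sum>b\<in>insert v B. (c(v := s)) b *\<^sub>R b) \<partial>lborel) \<partial>?P)"
      using B(5) \<open>v \<notin> B\<close> by (intro product_nn_integral_insert) measurable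
    also have "\<dots> = (\<integral>\<^sup>+c. (\<integral>\<^sup>+s. u (E c + s *\<^sub>R v) \<partial>lborel) \<partial>?P)"
    proof -
      have "(\<Sum>b\<in>insert v B. (c(v := s)) b *\<^sub>R b) = E c + s *\<^sub>R v" for c s
      proof -
        have "(\<Sum>b\<in>B. (c(v := s)) b *\<^sub>R b) = E c"
          unfolding E_def using \<open>v \<notin> B\<close> by (intro sum.cong) auto
        then show ?thesis using \<open>v \<notin> B\<close> B(5) by simp
      qed
      then show ?thesis by simp
    qed
    finally show "(\<integral>\<^sup>+x. u x \<partial>lborel) = (\<integral>\<^sup>+c. (\<integral>\<^sup>+s. u (E c + s *\<^sub>R v) \<partial>lborel) \<partial>?P)" .
  qed
  have proj_eq: "(\<integral>\<^sup>+x. proj_fun H u x \<partial>lebesgue_sub H) = (\<integral>\<^sup>+c. (SUP s. u (E c + s *\<^sub>R v)) \<partial>?P)"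
    for u :: "real ^ 'n \<Rightarrow> ennreal"
    using nn_integral_lebesgue_sub[of H "proj_fun H u", folded B_def, OF B(1) B(5) B(2,3,4)]
    by (simp add: proj_fun_def E_def v_def)
  obtain f0 where f0: "f0 \<in> borel_measurable lborel" "\<And>x. f0 x \<le> f x"
      "(\<integral>\<^sup>+x. f x \<partial>lebesgue) = (\<integral>\<^sup>+x. f0 x \<partial>lborel)"
    using completion_borel_minorant[OF assms(5)] by blast
  obtain g0 where g0: "g0 \<in> borel_measurable lborel" "\<And>x. g0 x \<le> g x"
      "(\<integral>\<^sup>+x. g x \<partial>lebesgue) = (\<integral>\<^sup>+x. g0 x \<partial>lborel)"
    using completion_borel_minorant[OF assms(6)] by blast
  obtain h where h: "h \<in> borel_measurable lborel" "\<And>x. sup_conv p lam f g x \<le> h x"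
      "(\<integral>\<^sup>+x. sup_conv p lam f g x \<partial>lebesgue) = (\<integral>\<^sup>+x. h x \<partial>lborel)"
    using completion_borel_majorant[OF assms(7)] by auto
  \<comment> \<open>Here p \<ge> -1/n enters: it gives n \<le> -1/p, and B has one vector fewer than
    n, so the inequality is strict even for p = -1/n.\<close>
  have p: "real (card B) < - 1 / p"
  proof -
    have "real CARD('n) * (- p) \<le> 1" using assms(1) by (simp add: field_simps)
    then have "real CARD('n) \<le> - 1 / p" using assms(2) by (simp add: field_simps)
    moreover have "real (card B) < real CARD('n)" unfolding card_B by simp
    ultimately show ?thesis by linarith
  qed
  have "ennreal (1 - lam) * (\<integral>\<^sup>+c. (\<integral>\<^sup>+s. f0 (E c + s *\<^sub>R v) \<partial>lborel) \<partial>?P)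
      + ennreal lam * (\<integral>\<^sup>+c. (\<integral>\<^sup>+s. g0 (E c + s *\<^sub>R v) \<partial>lborel) \<partial>?P)
    \<le> (\<integral>\<^sup>+c. (\<integral>\<^sup>+s. h (E c + s *\<^sub>R v) \<partial>lborel) \<partial>?P)"
  proof (rule linear_inequality_product[where f = "\<lambda>c s. f (E c + s *\<^sub>R v)" and g = "\<lambda>c s. g (E c + s *\<^sub>R v)",
        OF B(5) _ f0(2) _ g0(2) _ assms(2) p assms(3,4)])
    show "(\<integral>\<^sup>+c. (SUP s. f (E c + s *\<^sub>R v)) \<partial>?P) = (\<integral>\<^sup>+c. (SUP s. g (E c + s *\<^sub>R v)) \<partial>?P)"
      using proj by (simp only: proj_eq)
    fix x y :: "real ^ 'n \<Rightarrow> real" and s t :: real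
    have "E (\<lambda>i\<in>B. (1 - lam) * x i + lam * y i) = (1 - lam) *\<^sub>R E x + lam *\<^sub>R E y"
      unfolding E_def by (simp add: scaleR_sum_right scaleR_add_left flip: sum.distrib)
    then have eq: "E (\<lambda>i\<in>B. (1 - lam) * x i + lam * y i) + ((1 - lam) * s + lam * t) *\<^sub>R v =
      (1 - lam) *\<^sub>R (E x + s *\<^sub>R v) + lam *\<^sub>R (E y + t *\<^sub>R v)"
      by (simp add: scaleR_add_left scaleR_add_right)
    have "p_mean p (f (E x + s *\<^sub>R v)) (g (E y + t *\<^sub>R v)) lam
      \<le> sup_conv p lam f g (E (\<lambda>i\<in>B. (1 - lam) * x i + lam * y i) + ((1 - lam) * s + lam * t) *\<^sub>R v)"
      unfolding eq sup_conv_def by (rule Sup_upper) blast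
    also note h(2)
    finally show "p_mean p (f (E x + s *\<^sub>R v)) (g (E y + t *\<^sub>R v)) lam
      \<le> h (E (\<lambda>i\<in>B. (1 - lam) * x i + lam * y i) + ((1 - lam) * s + lam * t) *\<^sub>R v)" .
  qed (use coord(1) f0(1) g0(1) h(1) in simp_all)
  then show ?thesis
    using f0(1) g0(1) h(1) by (simp add: f0(3) g0(3) h(3) coord(2))
qed

end
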